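(* Let $L=(L_1,L_1',L_2,L_2')\in\mathbb{R}^4$ satisfy $L_1'<L_1$ and $L_2'<L_2$. Let $\rho^0\in L^1(\mathbb{R}^2)\cap L^\infty(\mathbb{R}^2)$ with $\rho^0\ge 0$ have compact support included in $C_L=[L_1',L_1]\times[L_2',L_2]$. For every integer $N\ge 1$ let $\hat\rho^N$ be the piecewise constant density associated with $\rho^0$, $L$, $N$ (defined in the context). Then for every $\varphi\in C_c^\infty(\mathbb{R}^2)$ and every $N\ge 1$, $$\left|\iint_{\mathbb{R}^2}\hat\rho^N(x,y)\varphi(x,y)\,dx\,dy-\iint_{\mathbb{R}^2}\rho^0(x,y)\varphi(x,y)\,dx\,dy\right|\le\frac{D_{1,2}(\varphi)}{N},$$ where $$D_{1,2}(\varphi)=\max(\Delta_1,\Delta_2)\,(\|\partial_x\varphi\|_\infty+\|\partial_y\varphi\|_\infty)\,(\|\rho^0\|_1+\|\rho^0\|_\infty\Delta_1\Delta_2).$$ Moreover, let $\omega^0\in L^\infty(\mathbb{R}^2)$ be such that $\partial_x\omega^0,\partial_y\omega^0\in L^\infty(\mathbb{R}^2)$, and let $\hat\rho^N\hat\omega^N$ be the associated piecewise constant quantity (defined in the context). Then for every $\varphi\in C_c^\infty(\mathbb{R}^2)$ and every $N\ge 1$, $$\left|\iint_{\mathbb{R}^2}(\hat\rho^N\hat\omega^N)(x,y)\varphi(x,y)\,dx\,dy-\iint_{\mathbb{R}^2}\rho^0(x,y)\omega^0(x,y)\varphi(x,y)\,dx\,dy\right|\le\frac{K_{1,2}(\varphi)+D_{1,2}(\varphi)\|\omega^0\|_\infty}{N},$$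 where $$K_{1,2}(\varphi)=\max(\Delta_1,\Delta_2)\,(\|\partial_x\omega^0\|_\infty+\|\partial_y\omega^0\|_\infty)\,\|\varphi\|_\infty\,\|\rho^0\|_1.$$
   Context: Notation: $\Delta_1=L_1-L_1'$, $\Delta_2=L_2-L_2'$. For an integer $N\ge1$ and $k\in\{0,\dots,N\}$, $\overline{x}_k^N=L_1'+k\frac{\Delta_1}{N}$ and $\overline{y}_k^N=L_2'+k\frac{\Delta_2}{N}$. For $i,j\in\{0,\dots,N-1\}$, $$a_{i,j}^N=\frac{N^2}{\Delta_1\Delta_2}\int_{\overline{x}_i^N}^{\overline{x}_{i+1}^N}\int_{\overline{y}_j^N}^{\overline{y}_{j+1}^N}\rho^0(x,y)\,dy\,dx,\qquad W_{i,j}^N=\frac{N^2}{\Delta_1\Delta_2}\int_{\overline{x}_i^N}^{\overline{x}_{i+1}^N}\int_{\overline{y}_j^N}^{\overline{y}_{j+1}^N}\omega^0(x,y)\,dy\,dx.$$ The piecewise constant density is $$\hat\rho^N(x,y)=\sum_{i=0}^{N-1}\sum_{j=0}^{N-1}a_{i,j}^N\,\mathbf{1}_{[\overline{x}_i^N,\overline{x}_{i+1}^N[}(x)\,\mathbf{1}_{[\overline{y}_j^N,\overline{y}_{j+1}^N[}(y),$$ and the piecewise constant quantity $\hat\rho^N\hat\omega^N$ (a single function) is $$(\hat\rho^N\hat\omega^N)(x,y)=\sum_{i=0}^{N-1}\sum_{j=0}^{N-1}a_{i,j}^N W_{i,j}^N\,\mathbf{1}_{[\overline{x}_i^N,\overline{x}_{i+1}^N[}(x)\,\mathbf{1}_{[\overline{y}_j^N,\overline{y}_{j+1}^N[}(y).$$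 $\|\cdot\|_1$ and $\|\cdot\|_\infty$ are the norms of $L^1(\mathbb{R}^2)$ and $L^\infty(\mathbb{R}^2)$. Partial derivatives of $\omega^0$ are weak derivatives. *)

theory Defs
  imports "HOL-Analysis.Analysis" "HOL-Probability.Essential_Supremum"
begin

text \<open>
  Elements of \<open>L\<^sup>1\<close> and \<open>L\<^sup>\<infinity>\<close> are represented by Lebesgue measurable
  functions on the plane. Every notion below that is applied to such an element is invariant
  under changing it on a Lebesgue null set.
\<close>

definition Linf :: "(real \<times> real \<Rightarrow> real) \<Rightarrow> bool"
  where "Linf f \<longleftrightarrow>
    f \<in> borel_measurable lebesgue \<and> esssup lebesgue (\<lambda>p. ereal \<bar>f p\<bar>) < \<infinity>"

definition norm_Linf :: "(real \<times> real \<Rightarrow> real) \<Rightarrow> real"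
  where "norm_Linf f = real_of_ereal (esssup lebesgue (\<lambda>p. ereal \<bar>f p\<bar>))"

definition norm_L1 :: "(real \<times> real \<Rightarrow> real) \<Rightarrow> real"
  where "norm_L1 f = (LINT p|lebesgue. \<bar>f p\<bar>)"

text \<open>
  The support of an equivalence class of measurable functions: the complement of the largest
  open set on which the function vanishes almost everywhere.
\<close>

definition ess_support :: "(real \<times> real \<Rightarrow> real) \<Rightarrow> (real \<times> real) set"
  where "ess_support f = - \<Union>{U. open U \<and> (AE p in lebesgue. p \<in> U \<longrightarrow> f p = 0)}"

definition partial_x :: "(real \<times> real \<Rightarrow> real) \<Rightarrow> real \<times> real \<Rightarrow> real"
  where "partial_x f p = deriv (\<lambda>t. f (t, snd p)) (fst p)"

definition partial_y :: "(real \<times> real \<Rightarrow> real) \<Rightarrow> real \<times> real \<Rightarrow> real"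
  where "partial_y f p = deriv (\<lambda>t. f (fst p, t)) (snd p)"

text \<open>All iterated partial derivatives up to order \<open>k\<close> exist and are continuous.\<close>

primrec Ck :: "nat \<Rightarrow> (real \<times> real \<Rightarrow> real) \<Rightarrow> bool"
  where
    "Ck 0 f \<longleftrightarrow> continuous_on UNIV f"
  | "Ck (Suc k) f \<longleftrightarrow>
      continuous_on UNIV f \<and>
      (\<forall>x y. (\<lambda>t. f (t, y)) differentiable (at x) \<and> (\<lambda>t. f (x, t)) differentiable (at y)) \<and>
      Ck k (partial_x f) \<and> Ck k (partial_y f)"

definition test_function :: "(real \<times> real \<Rightarrow> real) \<Rightarrow> bool"
  where "test_function \<phi> \<longleftrightarrow> (\<forall>k. Ck k \<phi>) \<and> compact (closure {p. \<phi> p \<noteq> 0})"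

definition locally_integrable :: "(real \<times> real \<Rightarrow> real) \<Rightarrow> bool"
  where "locally_integrable f \<longleftrightarrow> (\<forall>K. compact K \<longrightarrow> set_integrable lebesgue K f)"

definition weak_partial_x :: "(real \<times> real \<Rightarrow> real) \<Rightarrow> (real \<times> real \<Rightarrow> real) \<Rightarrow> bool"
  where "weak_partial_x f g \<longleftrightarrow>
    locally_integrable f \<and> locally_integrable g \<and>
    (\<forall>\<phi>. test_function \<phi> \<longrightarrow>
      (LINT p|lebesgue. f p * partial_x \<phi> p) = - (LINT p|lebesgue. g p * \<phi> p))"

definition weak_partial_y :: "(real \<times> real \<Rightarrow> real) \<Rightarrow> (real \<times> real \<Rightarrow> real) \<Rightarrow> bool"
  where "weak_partial_y f g \<longleftrightarrow>
    locally_integrable f \<and> locally_integrable g \<and>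
    (\<forall>\<phi>. test_function \<phi> \<longrightarrow>
      (LINT p|lebesgue. f p * partial_y \<phi> p) = - (LINT p|lebesgue. g p * \<phi> p))"

text \<open>
  \<open>grid l' l N k\<close> is the \<open>k\<close>-th of the \<open>N + 1\<close> equidistant points from
  \<open>l'\<close> to \<open>l\<close>; both coordinate grids are instances of it.
\<close>

definition grid :: "real \<Rightarrow> real \<Rightarrow> nat \<Rightarrow> nat \<Rightarrow> real"
  where "grid l' l N k = l' + real k * ((l - l') / real N)"

text \<open>
  Mean value over a grid cell; with \<open>f\<close> the initial density this is \<open>a\<close>, with
  \<open>f\<close> the second initial quantity it is \<open>W\<close>. The iterated integral uses
  \<open>lebesgue\<close> rather than \<open>lborel\<close> in each variable, since the sections of a
  Lebesgue measurable function are in general only Lebesgue measurable (for almost every section).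
\<close>

definition cell_mean ::
    "real \<Rightarrow> real \<Rightarrow> real \<Rightarrow> real \<Rightarrow> (real \<times> real \<Rightarrow> real) \<Rightarrow> nat \<Rightarrow> nat \<Rightarrow> nat \<Rightarrow> real"
  where "cell_mean L1 L1' L2 L2' f N i j =
    (real N)\<^sup>2 / ((L1 - L1') * (L2 - L2')) *
    (LINT x:{grid L1' L1 N i..grid L1' L1 N (Suc i)}|lebesgue.
      (LINT y:{grid L2' L2 N j..grid L2' L2 N (Suc j)}|lebesgue. f (x, y)))"

definition piecewise_const ::
    "real \<Rightarrow> real \<Rightarrow> real \<Rightarrow> real \<Rightarrow> nat \<Rightarrow> (nat \<Rightarrow> nat \<Rightarrow> real) \<Rightarrow> real \<times> real \<Rightarrow> real"
  where "piecewise_const L1 L1' L2 L2' N c p =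
    (\<Sum>i<N. \<Sum>j<N. c i j *
      indicator {grid L1' L1 N i..<grid L1' L1 N (Suc i)} (fst p) *
      indicator {grid L2' L2 N j..<grid L2' L2 N (Suc j)} (snd p))"

definition rho_hat ::
    "real \<Rightarrow> real \<Rightarrow> real \<Rightarrow> real \<Rightarrow> (real \<times> real \<Rightarrow> real) \<Rightarrow> nat \<Rightarrow> real \<times> real \<Rightarrow> real"
  where "rho_hat L1 L1' L2 L2' \<rho> N =
    piecewise_const L1 L1' L2 L2' N (cell_mean L1 L1' L2 L2' \<rho> N)"

definition rho_omega_hat ::
    "real \<Rightarrow> real \<Rightarrow> real \<Rightarrow> real \<Rightarrow> (real \<times> real \<Rightarrow> real) \<Rightarrow> (real \<times> real \<Rightarrow> real) \<Rightarrow> nat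
      \<Rightarrow> real \<times> real \<Rightarrow> real"
  where "rho_omega_hat L1 L1' L2 L2' \<rho> \<omega> N =
    piecewise_const L1 L1' L2 L2' N
      (\<lambda>i j. cell_mean L1 L1' L2 L2' \<rho> N i j * cell_mean L1 L1' L2 L2' \<omega> N i j)"

definition D12 ::
    "real \<Rightarrow> real \<Rightarrow> real \<Rightarrow> real \<Rightarrow> (real \<times> real \<Rightarrow> real) \<Rightarrow> (real \<times> real \<Rightarrow> real) \<Rightarrow> real"
  where "D12 L1 L1' L2 L2' \<rho> \<phi> =
    max (L1 - L1') (L2 - L2') *
    (norm_Linf (partial_x \<phi>) + norm_Linf (partial_y \<phi>)) *
    (norm_L1 \<rho> + norm_Linf \<rho> * (L1 - L1') * (L2 - L2'))"

text \<open>
  The arguments \<open>\<omega>x\<close> and \<open>\<omega>y\<close> stand for the weak partial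
  derivatives of the second initial quantity.
\<close>

definition K12 ::
    "real \<Rightarrow> real \<Rightarrow> real \<Rightarrow> real \<Rightarrow> (real \<times> real \<Rightarrow> real) \<Rightarrow> (real \<times> real \<Rightarrow> real)
      \<Rightarrow> (real \<times> real \<Rightarrow> real) \<Rightarrow> (real \<times> real \<Rightarrow> real) \<Rightarrow> real"
  where "K12 L1 L1' L2 L2' \<rho> \<omega>x \<omega>y \<phi> =
    max (L1 - L1') (L2 - L2') *
    (norm_Linf \<omega>x + norm_Linf \<omega>y) * norm_Linf \<phi> * norm_L1 \<rho>"

end

theory Submission
  imports Defs
begin

text \<open>
  On a grid cell with sides \<open>h1\<close> and \<open>h2\<close> let \<open>a\<close> and \<open>W\<close> be the means of \<open>\<rho>\<close> and \<open>\<omega>\<close>.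

  First estimate. The function \<open>a - \<rho>\<close> has integral zero over the cell, so a constant can be
  subtracted from \<open>\<phi>\<close> before integrating \<open>(a - \<rho>) * \<phi>\<close>. By the mean value theorem \<open>\<phi>\<close> differs from its
  value at the lower left corner by at most
  \<open>\<delta> = norm_Linf (partial_x \<phi>) * h1 + norm_Linf (partial_y \<phi>) * h2\<close>. Since \<open>\<rho>\<close> is nonnegative, the
  error on the cell is at most \<open>\<delta>\<close> times the integral of \<open>a + \<rho>\<close>, that is, \<open>2 * \<delta>\<close> times the mass of \<open>\<rho>\<close> in
  the cell (\<open>mean_defect_bound\<close>, \<open>density_cell_bound\<close>). Summation gives
  \<open>2 * \<delta> * norm_L1 \<rho>\<close>; one of the two copies of \<open>norm_L1 \<rho>\<close> is estimated by \<open>norm_Linf \<rho>\<close> times the area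
  of the rectangle.

  Second estimate. Write \<open>a * W - \<rho> * \<omega> = W * (a - \<rho>) + \<rho> * (W - \<omega>)\<close>. As \<open>\<bar>W\<bar> \<le> norm_Linf \<omega>\<close>, the first
  summand is covered by the first estimate. The second one needs
  \<open>\<bar>\<omega> - W\<bar> \<le> norm_Linf \<omega>x * h1 + norm_Linf \<omega>y * h2\<close> almost everywhere on the cell, which is
  \<open>weak_derivative_bounded_oscillation\<close>. It is proved from the definition of the weak
  derivative, without mollifying \<open>\<omega>\<close> and without a continuous representative. Let \<open>u\<close> and \<open>u'\<close> be smooth probability
  densities on the same interval \<open>[a, b]\<close>, and \<open>v\<close> one on \<open>[c, d]\<close>. The difference \<open>u - u'\<close> has a primitive
  \<open>F\<close> that vanishes outside \<open>[a, b]\<close> and satisfies \<open>\<bar>F\<bar> \<le> 1\<close>. So the product of \<open>F\<close> and \<open>v\<close> is a test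
  function, and testing the weak derivative with it shows that exchanging \<open>u\<close> for \<open>u'\<close> changes the
  average of \<open>\<omega>\<close> by at most \<open>norm_Linf \<omega>x * (b - a)\<close>. Likewise for the other coordinate. Letting
  the densities approach normalised indicator functions, the means of \<open>\<omega>\<close> over the cell and over any
  box inside it are compared (\<open>weak_derivative_box_means\<close>), and letting the box shrink to a point
  gives the claim by Lebesgue's differentiation theorem.
\<close>

section \<open>Essentially bounded functions\<close>

lemma Linf_AE_bound:
  assumes "Linf f"
  shows "AE p in lebesgue. \<bar>f p\<bar> \<le> norm_Linf f"
  using esssup_AE[of "\<lambda>p. ereal \<bar>f p\<bar>" lebesgue]
proof eventually_elim
  case (elim p)
  moreover have "0 \<le> ereal \<bar>f p\<bar>" by simp
  ultimately have "0 \<le> esssup lebesgue (\<lambda>p. ereal \<bar>f p\<bar>)" by (rule order_trans[rotated])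
  with elim assms show ?case
    unfolding norm_Linf_def Linf_def
    by (cases "esssup lebesgue (\<lambda>p. ereal \<bar>f p\<bar>)") auto
qed

lemma AE_lebesgue_const:
  assumes "AE p in (lebesgue :: (real \<times> real) measure). P"
  shows P
  using assms by (cases P) (auto simp: ae_filter_eq_bot_iff trivial_limit_def[symmetric] eventually_False)

lemma norm_Linf_nonneg:
  assumes "Linf f" shows "0 \<le> norm_Linf f"
proof -
  have "AE p in (lebesgue :: (real \<times> real) measure). 0 \<le> norm_Linf f"
    using Linf_AE_bound[OF assms] by eventually_elim (rule order_trans[OF abs_ge_zero])
  then show ?thesis by (rule AE_lebesgue_const)
qed

lemma integrable_Linf_mult:
  assumes "Linf f" "integrable lebesgue g"
  shows "integrable lebesgue (\<lambda>p. f p * g p)"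
proof (rule Bochner_Integration.integrable_bound)
  show "integrable lebesgue (\<lambda>p. norm_Linf f * \<bar>g p\<bar>)" using assms(2) by simp
  show "(\<lambda>p. f p * g p) \<in> borel_measurable lebesgue"
    using assms by (auto simp: Linf_def intro!: borel_measurable_times)
  show "AE p in lebesgue. norm (f p * g p) \<le> norm (norm_Linf f * \<bar>g p\<bar>)"
    using Linf_AE_bound[OF assms(1)]
    by eventually_elim (auto simp: abs_mult norm_Linf_nonneg[OF assms(1)] intro!: mult_right_mono)
qed

lemma integral_Linf_mult_bound:
  assumes "Linf f" "integrable lebesgue h" "\<And>p. \<bar>g p\<bar> \<le> h p"
  shows "\<bar>LINT p|lebesgue. f p * g p\<bar> \<le> norm_Linf f * (LINT p|lebesgue. h p)"
proof -
  have "\<bar>LINT p|lebesgue. f p * g p\<bar> \<le> (LINT p|lebesgue. \<bar>f p * g p\<bar>)"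
    by simp
  also have "\<dots> \<le> (LINT p|lebesgue. norm_Linf f * h p)"
  proof (rule integral_mono_AE')
    show "integrable lebesgue (\<lambda>p. norm_Linf f * h p)" using assms(2) by simp
    show "AE p in lebesgue. \<bar>f p * g p\<bar> \<le> norm_Linf f * h p"
      using Linf_AE_bound[OF assms(1)]
      by eventually_elim (use assms(3) in \<open>auto simp: abs_mult intro!: mult_mono\<close>)
    have "0 \<le> h p" for p using assms(3)[of p] by linarith
    then show "AE p in lebesgue. 0 \<le> norm_Linf f * h p"
      using norm_Linf_nonneg[OF assms(1)] by simp
  qed
  finally show ?thesis by simp
qed

lemma set_integrable_Linf:
  assumes "Linf f" "S \<in> lmeasurable"
  shows "set_integrable lebesgue S f"
proof -
  have "integrable lebesgue (indicator S :: _ \<Rightarrow> real)"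
    using assms(2) by (intro integrable_real_indicator) (auto simp: fmeasurable_def)
  from integrable_Linf_mult[OF assms(1) this] show ?thesis
    by (simp add: set_integrable_def mult.commute)
qed

lemma Linf_bounded:
  assumes "f \<in> borel_measurable lebesgue" "\<And>p. \<bar>f p\<bar> \<le> c"
  shows "Linf f"
proof -
  have "(\<lambda>p. ereal \<bar>f p\<bar>) \<in> borel_measurable lebesgue"
    using assms(1) by measurable
  then have "esssup lebesgue (\<lambda>p. ereal \<bar>f p\<bar>) \<le> ereal c"
    by (rule esssup_I) (use assms(2) in simp)
  then show ?thesis
    using assms(1) by (auto simp: Linf_def)
qed

lemma Linf_continuous_compact:
  fixes f :: "real \<times> real \<Rightarrow> real"
  assumes "continuous_on UNIV f" "compact K" "\<And>p. p \<notin> K \<Longrightarrow> f p = 0"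
  shows "Linf f"
proof -
  have "compact (f ` K)"
    using assms(1,2) by (intro compact_continuous_image continuous_on_subset[OF assms(1)]) auto
  then obtain c where c: "\<And>p. p \<in> K \<Longrightarrow> \<bar>f p\<bar> \<le> c"
    using compact_imp_bounded[of "f ` K"] by (auto simp: bounded_iff)
  have "\<bar>f p\<bar> \<le> max c 0" for p
    using c[of p] assms(3)[of p] by (cases "p \<in> K") auto
  moreover have "f \<in> borel_measurable lebesgue"
    using borel_measurable_continuous_onI[OF assms(1)] by (intro measurable_completion) simp
  ultimately show ?thesis by (intro Linf_bounded)
qed

text \<open>
  The set where a continuous function exceeds its essential bound is open and null, hence empty.
\<close>

lemma continuous_le_norm_Linf:
  assumes "continuous_on UNIV f" "Linf f"
  shows "\<bar>f p\<bar> \<le> norm_Linf f"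
proof (rule ccontr)
  assume "\<not> \<bar>f p\<bar> \<le> norm_Linf f"
  let ?U = "{p. norm_Linf f < \<bar>f p\<bar>}"
  have "open ?U" using assms(1) by (intro open_Collect_less continuous_intros)
  moreover have "p \<in> ?U" using \<open>\<not> \<bar>f p\<bar> \<le> norm_Linf f\<close> by simp
  ultimately have "\<not> negligible ?U" using open_not_negligible by blast
  moreover have "negligible ?U"
    using Linf_AE_bound[OF assms(2)] unfolding negligible_iff_null_sets
    by (subst (asm) completion.AE_iff_null_sets) (simp add: not_le)
  ultimately show False by blast
qed

text \<open>
  The union in the definition of the support is uncountable, but by Lindelof's theorem countably
  many of its members already cover it.
\<close>

lemma AE_zero_outside_ess_support: "AE p in lebesgue. p \<notin> ess_support f \<longrightarrow> f p = 0"
proof -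
  let ?F = "{U. open U \<and> (AE p in lebesgue. p \<in> U \<longrightarrow> f p = 0)}"
  obtain F' where F': "F' \<subseteq> ?F" "countable F'" "\<Union>F' = \<Union>?F"
    using Lindelof[of ?F] by blast
  have "AE p in lebesgue. \<forall>U\<in>F'. p \<in> U \<longrightarrow> f p = 0"
    using F' by (subst AE_ball_countable) auto
  then show ?thesis
  proof eventually_elim
    case (elim p)
    show ?case
    proof
      assume "p \<notin> ess_support f"
      then have "p \<in> \<Union>F'" unfolding F'(3) ess_support_def by blast
      then show "f p = 0" using elim by blast
    qed
  qed
qed

section \<open>Integration over the plane\<close>

lemma tensor_integral:
  fixes f g :: "real \<Rightarrow> real"
  assumes "integrable lborel f" "integrable lborel g"
  shows "integrable lebesgue (\<lambda>p. f (fst p) * g (snd p))"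
    and "(LINT p|lebesgue. f (fst p) * g (snd p)) = (LINT t|lborel. f t) * (LINT t|lborel. g t)"
proof -
  have m[measurable]: "f \<in> borel_measurable borel" "g \<in> borel_measurable borel"
    using assms by auto
  have int: "integrable (lborel \<Otimes>\<^sub>M lborel) (\<lambda>p. f (fst p) * g (snd p))"
    using assms by (intro lborel_pair.Fubini_integrable) (auto simp: abs_mult)
  have meas: "(\<lambda>p. f (fst p) * g (snd p)) \<in> borel_measurable (lborel :: (real \<times> real) measure)"
    using borel_measurable_integrable[OF int] by (simp only: lborel_prod)
  show "integrable lebesgue (\<lambda>p. f (fst p) * g (snd p))"
    using int integrable_completion[OF meas] by (simp add: lborel_prod)
  show "(LINT p|lebesgue. f (fst p) * g (snd p)) = (LINT t|lborel. f t) * (LINT t|lborel. g t)"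
    using lborel_pair.integral_fst'[OF int] integral_completion[OF meas] by (simp add: lborel_prod)
qed

lemma integrable_indicator_Icc: "integrable lborel (indicator {a..b} :: real \<Rightarrow> real)"
  by (intro integrable_real_indicator) (auto simp: emeasure_lborel_Icc_eq)

lemma AE_lebesgue_coordinates_neq:
  "AE p in (lebesgue :: (real \<times> real) measure). fst p \<noteq> c \<and> snd p \<noteq> c'"
proof -
  have "negligible {p :: real \<times> real. p \<bullet> (1, 0) = c}" "negligible {p :: real \<times> real. p \<bullet> (0, 1) = c'}"
    by (auto intro!: negligible_standard_hyperplane simp: Basis_prod_def)
  then have "negligible {p :: real \<times> real. fst p = c}" "negligible {p :: real \<times> real. snd p = c'}"
    by (auto simp: inner_Pair inner_prod_def)
  then have "{p :: real \<times> real. fst p = c} \<in> null_sets lebesgue" "{p :: real \<times> real. snd p = c'} \<in> null_sets lebesgue"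
    by (auto simp: negligible_iff_null_sets)
  from this[THEN AE_not_in] show ?thesis
    by eventually_elim auto
qed

text \<open>
  The product measure of two completed measures is not complete, so Fubini's theorem is transferred
  from Borel functions: \<open>f\<close> agrees almost everywhere with a Borel function \<open>g\<close>, and then almost every
  section of \<open>f\<close> agrees almost everywhere with that of \<open>g\<close>.
\<close>

lemma lebesgue_Fubini:
  fixes f :: "real \<times> real \<Rightarrow> real"
  assumes "integrable lebesgue f"
  shows "(LINT x|lebesgue. LINT y|lebesgue. f (x, y)) = (LINT p|lebesgue. f p)"
proof -
  obtain g where g[measurable]: "g \<in> borel_measurable lborel" and fg: "AE p in lborel. f p = g p"
    using completion_ex_borel_measurable_real assms by blast
  have fg': "AE p in lebesgue. f p = g p"
    using fg by (rule AE_completion)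
  have g_leb: "g \<in> borel_measurable lebesgue"
    using g by (rule measurable_completion)
  have "integrable lebesgue g"
    using integrable_cong_AE[OF _ g_leb fg'] assms by auto
  then have "integrable lborel g"
    using integrable_completion[OF g] by simp
  then have g_int: "integrable (lborel \<Otimes>\<^sub>M lborel) g"
    by (simp add: lborel_prod)
  have "AE x in lborel. AE y in lborel. f (x, y) = g (x, y)"
    using fg by (intro lborel_pair.AE_pair) (simp only: lborel_prod)
  then have "AE x in lborel. (LINT y|lebesgue. f (x, y)) = (LINT y|lborel. g (x, y))"
  proof eventually_elim
    case (elim x)
    have gx: "(\<lambda>y. g (x, y)) \<in> borel_measurable lborel" by measurable
    have gx_leb: "(\<lambda>y. g (x, y)) \<in> borel_measurable lebesgue"
      using gx by (rule measurable_completion)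
    have ae: "AE y in lebesgue. f (x, y) = g (x, y)" using elim by (rule AE_completion)
    have "AE y in lebesgue. g (x, y) = f (x, y)" using ae by eventually_elim simp
    then have "(\<lambda>y. f (x, y)) \<in> borel_measurable lebesgue"
      by (rule borel_measurable_AE[OF gx_leb])
    then have "(LINT y|lebesgue. f (x, y)) = (LINT y|lebesgue. g (x, y))"
      using gx_leb ae by (rule integral_cong_AE)
    also have "\<dots> = (LINT y|lborel. g (x, y))"
      using gx by (rule integral_completion)
    finally show ?case .
  qed
  then have ae: "AE x in lebesgue. (LINT y|lebesgue. f (x, y)) = (LINT y|lborel. g (x, y))"
    by (rule AE_completion)
  have h: "(\<lambda>x. LINT y|lborel. g (x, y)) \<in> borel_measurable lborel"
    using lborel_pair.integrable_fst'[OF g_int] by auto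
  have h_leb: "(\<lambda>x. LINT y|lborel. g (x, y)) \<in> borel_measurable lebesgue"
    using h by (rule measurable_completion)
  have "AE x in lebesgue. (LINT y|lborel. g (x, y)) = (LINT y|lebesgue. f (x, y))"
    using ae by eventually_elim simp
  then have "(\<lambda>x. LINT y|lebesgue. f (x, y)) \<in> borel_measurable lebesgue"
    by (rule borel_measurable_AE[OF h_leb])
  then have "(LINT x|lebesgue. LINT y|lebesgue. f (x, y)) = (LINT x|lebesgue. LINT y|lborel. g (x, y))"
    using h_leb ae by (rule integral_cong_AE)
  also have "\<dots> = (LINT x|lborel. LINT y|lborel. g (x, y))"
    using h by (rule integral_completion)
  also have "\<dots> = (LINT p|lborel. g p)"
    using lborel_pair.integral_fst'[OF g_int] by (simp add: lborel_prod)
  also have "\<dots> = (LINT p|lebesgue. g p)"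
    using g by (rule integral_completion[symmetric])
  also have "\<dots> = (LINT p|lebesgue. f p)"
    using assms g_leb fg' by (intro integral_cong_AE[symmetric]) auto
  finally show ?thesis .
qed

lemma set_lebesgue_Fubini:
  fixes f :: "real \<times> real \<Rightarrow> real"
  assumes "set_integrable lebesgue (S \<times> T) f"
  shows "(LINT x:S|lebesgue. LINT y:T|lebesgue. f (x, y)) = (LINT p:S \<times> T|lebesgue. f p)"
proof -
  have "(LINT x:S|lebesgue. LINT y:T|lebesgue. f (x, y))
      = (LINT x|lebesgue. LINT y|lebesgue. indicator (S \<times> T) (x, y) *\<^sub>R f (x, y))"
    by (simp add: set_lebesgue_integral_def indicator_times mult.assoc)
  also have "\<dots> = (LINT p:S \<times> T|lebesgue. f p)"
    using assms unfolding set_lebesgue_integral_def set_integrable_def by (rule lebesgue_Fubini)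
  finally show ?thesis .
qed

lemma half_open_box:
  fixes a b c d :: real
  assumes "a \<le> b" "c \<le> d"
  shows "{a..<b} \<times> {c..<d} \<in> lmeasurable"
    and "measure lebesgue ({a..<b} \<times> {c..<d}) = (b - a) * (d - c)"
proof -
  let ?S = "{a..<b} \<times> {c..<d}"
  have "?S \<in> sets borel"
    unfolding borel_prod[symmetric] by (intro pair_measureI) auto
  then have S: "?S \<in> sets lebesgue" by auto
  moreover have "bounded ?S"
    by (intro bounded_Times) (auto intro: bounded_subset[OF bounded_closed_interval[of a b]]
        bounded_subset[OF bounded_closed_interval[of c d]])
  ultimately show "?S \<in> lmeasurable"
    using bounded_set_imp_lmeasurable by blast
  have ind: "integrable lborel (indicator {s..<t} :: real \<Rightarrow> real)" "(LINT u|lborel. indicator {s..<t} u) = t - s"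
    if "s \<le> t" for s t :: real
    using that by (auto intro!: integrable_real_indicator)
  have "measure lebesgue ?S = (LINT p|lebesgue. indicator ?S p)"
    using S by simp
  also have "\<dots> = (LINT p|lebesgue. indicator {a..<b} (fst p) * indicator {c..<d} (snd p))"
    by (intro Bochner_Integration.integral_cong) (auto simp: indicator_def mem_Times_iff)
  also have "\<dots> = (b - a) * (d - c)"
    using ind assms by (subst tensor_integral) auto
  finally show "measure lebesgue ?S = (b - a) * (d - c)" .
qed

lemma closed_box_lmeasurable:
  fixes a b c d :: real
  shows "{a..b} \<times> {c..d} \<in> lmeasurable"
  using lmeasurable_cbox[of "(a, c)" "(b, d)"] by (simp add: cbox_Pair_eq)

lemma set_integral_closed_box_half_open:
  fixes f :: "real \<times> real \<Rightarrow> real"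
  assumes "set_integrable lebesgue ({a..b} \<times> {c..d}) f"
  shows "(LINT p:{a..b} \<times> {c..d}|lebesgue. f p) = (LINT p:{a..<b} \<times> {c..<d}|lebesgue. f p)"
proof -
  have ae: "AE p in lebesgue. indicator ({a..b} \<times> {c..d}) p *\<^sub>R f p = indicator ({a..<b} \<times> {c..<d}) p *\<^sub>R f p"
    using AE_lebesgue_coordinates_neq[of b d] by eventually_elim (auto simp: indicator_def)
  have "(\<lambda>p. indicator ({a..b} \<times> {c..d}) p *\<^sub>R f p) \<in> borel_measurable lebesgue"
    using assms by (auto simp: set_integrable_def)
  from borel_measurable_AE[OF this ae] this ae show ?thesis
    unfolding set_lebesgue_integral_def by (intro integral_cong_AE)
qed

lemma set_integrable_of_integrable:
  fixes f :: "'a \<Rightarrow> real"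
  assumes "integrable M f" "S \<in> sets M"
  shows "set_integrable M S f"
  unfolding set_integrable_def using assms by (rule integrable_mult_indicator[rotated])

lemma sum_indicator_consecutive:
  fixes g :: "nat \<Rightarrow> real"
  assumes "mono g"
  shows "(\<Sum>i<n. indicator {g i..<g (Suc i)} t) = (indicator {g 0..<g n} t :: real)"
proof (induction n)
  case (Suc n)
  have "g 0 \<le> g n" "g n \<le> g (Suc n)" using assms by (auto simp: mono_def)
  then show ?case using Suc.IH by (auto simp: indicator_def)
qed simp

section \<open>Smooth bumps and test functions\<close>

text \<open>
  Existence of \<open>k\<close> successive derivatives. Exhibiting the derivative as a witness, instead of
  iterating \<open>deriv\<close>, makes the closure properties direct inductions on \<open>k\<close>.
\<close>

primrec smooth_upto :: "nat \<Rightarrow> (real \<Rightarrow> real) \<Rightarrow> bool"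
  where
    "smooth_upto 0 f \<longleftrightarrow> True"
  | "smooth_upto (Suc k) f \<longleftrightarrow>
      (\<exists>f'. (\<forall>t. (f has_real_derivative f' t) (at t)) \<and> smooth_upto k f')"

lemma smooth_upto_SucD: "smooth_upto (Suc k) f \<Longrightarrow> smooth_upto k f"
  by (induction k arbitrary: f) (simp, metis smooth_upto.simps(2))

lemma smooth_upto_const: "smooth_upto k (\<lambda>t. c)"
  by (induction k arbitrary: c) (auto intro!: exI[of _ "\<lambda>t. 0"])

lemma smooth_upto_add:
  "smooth_upto k f \<Longrightarrow> smooth_upto k g \<Longrightarrow> smooth_upto k (\<lambda>t. f t + g t)"
proof (induction k arbitrary: f g)
  case (Suc k)
  then obtain f' g' where "\<And>t. (f has_real_derivative f' t) (at t)" "smooth_upto k f'"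
    "\<And>t. (g has_real_derivative g' t) (at t)" "smooth_upto k g'" by auto
  then show ?case using Suc.IH
    by (auto intro!: exI[of _ "\<lambda>t. f' t + g' t"] derivative_eq_intros)
qed simp

lemma smooth_upto_mult:
  "smooth_upto k f \<Longrightarrow> smooth_upto k g \<Longrightarrow> smooth_upto k (\<lambda>t. f t * g t)"
proof (induction k arbitrary: f g)
  case (Suc k)
  then obtain f' g' where d: "\<And>t. (f has_real_derivative f' t) (at t)" "smooth_upto k f'"
    "\<And>t. (g has_real_derivative g' t) (at t)" "smooth_upto k g'" by auto
  have "smooth_upto k (\<lambda>t. f' t * g t + f t * g' t)"
    using Suc.prems[THEN smooth_upto_SucD] d by (intro smooth_upto_add Suc.IH) auto
  then show ?case using d
    by (auto intro!: exI[of _ "\<lambda>t. f' t * g t + f t * g' t"] derivative_eq_intros)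
qed simp

lemma smooth_upto_cmult: "smooth_upto k f \<Longrightarrow> smooth_upto k (\<lambda>t. c * f t)"
  by (intro smooth_upto_mult smooth_upto_const)

lemma smooth_upto_affine: "smooth_upto k f \<Longrightarrow> smooth_upto k (\<lambda>t. f (m * t + c))"
proof (induction k arbitrary: f)
  case (Suc k)
  then obtain f' where d: "\<And>t. (f has_real_derivative f' t) (at t)" "smooth_upto k f'" by auto
  have "((\<lambda>t. f (m * t + c)) has_real_derivative m * f' (m * t + c)) (at t)" for t
    by (rule DERIV_chain'[OF _ d(1), THEN DERIV_cong]) (auto intro!: derivative_eq_intros)
  moreover have "smooth_upto k (\<lambda>t. m * f' (m * t + c))"
    using Suc.IH[OF d(2)] by (rule smooth_upto_cmult)
  ultimately show ?case by (auto intro!: exI[of _ "\<lambda>t. m * f' (m * t + c)"])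
qed simp

lemma smooth_upto_SucE:
  assumes "smooth_upto (Suc k) f"
  shows "(f has_real_derivative deriv f t) (at t)" "smooth_upto k (deriv f)"
proof -
  obtain f' where d: "\<And>t. (f has_real_derivative f' t) (at t)" "smooth_upto k f'"
    using assms by auto
  then have "deriv f = f'" by (auto simp: DERIV_imp_deriv)
  with d show "(f has_real_derivative deriv f t) (at t)" "smooth_upto k (deriv f)" by auto
qed

lemma partial_tensor:
  assumes "smooth_upto (Suc k) f" "smooth_upto (Suc k) g"
  shows "partial_x (\<lambda>p. f (fst p) * g (snd p)) = (\<lambda>p. deriv f (fst p) * g (snd p))"
    and "partial_y (\<lambda>p. f (fst p) * g (snd p)) = (\<lambda>p. f (fst p) * deriv g (snd p))"
  by (auto simp: partial_x_def partial_y_def fun_eq_iff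
      intro!: DERIV_imp_deriv derivative_eq_intros assms[THEN smooth_upto_SucE(1)])

lemma smooth_upto_continuous:
  assumes "smooth_upto (Suc k) f"
  shows "continuous_on S f"
  using smooth_upto_SucE(1)[OF assms] DERIV_isCont continuous_at_imp_continuous_on by blast

lemma Ck_tensor:
  assumes "smooth_upto (Suc k) f" "smooth_upto (Suc k) g"
  shows "Ck k (\<lambda>p. f (fst p) * g (snd p))"
  using assms
proof (induction k arbitrary: f g)
  case 0
  show ?case unfolding Ck.simps
    by (intro continuous_on_mult continuous_on_compose2[OF smooth_upto_continuous[OF 0(1)]]
        continuous_on_compose2[OF smooth_upto_continuous[OF 0(2)]] continuous_intros) auto
next
  case (Suc k)
  have "continuous_on UNIV (\<lambda>p. f (fst p) * g (snd p))"
    by (intro continuous_on_mult continuous_on_compose2[OF smooth_upto_continuous[OF Suc(2)]]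
        continuous_on_compose2[OF smooth_upto_continuous[OF Suc(3)]] continuous_intros) auto
  moreover have "(\<lambda>t. f t * g y) differentiable at x" "(\<lambda>t. f x * g t) differentiable at y" for x y
    using Suc.prems[THEN smooth_upto_SucE(1)]
    by (auto simp: real_differentiable_def intro!: derivative_eq_intros exI)
  moreover have "Ck k (\<lambda>p. deriv f (fst p) * g (snd p))" "Ck k (\<lambda>p. f (fst p) * deriv g (snd p))"
    using Suc.prems[THEN smooth_upto_SucE(2)] Suc.prems[THEN smooth_upto_SucD]
    by (blast intro: Suc.IH)+
  ultimately show ?case
    by (simp add: partial_tensor[OF Suc.prems])
qed

lemma test_function_tensor:
  assumes "\<And>k. smooth_upto k f" "\<And>k. smooth_upto k g"
    and "\<And>t. t \<notin> {a..b} \<Longrightarrow> f t = 0" "\<And>t. t \<notin> {c..d} \<Longrightarrow> g t = 0"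
  shows "test_function (\<lambda>p. f (fst p) * g (snd p))"
proof -
  have "{p. f (fst p) * g (snd p) \<noteq> 0} \<subseteq> {a..b} \<times> {c..d}"
    using assms(3,4) by (force simp: mem_Times_iff simp del: atLeastAtMost_iff)
  then have "bounded {p. f (fst p) * g (snd p) \<noteq> 0}"
    by (rule bounded_subset[rotated]) (intro bounded_Times bounded_closed_interval)
  then show ?thesis
    by (auto simp: test_function_def compact_closure intro!: Ck_tensor assms simp del: smooth_upto.simps)
qed

text \<open>
  The functions \<open>q (1 / t) * exp (- 1 / t)\<close> on the positive half-line, for polynomials \<open>q\<close>. The family
  is closed under differentiation, which is why all its members are smooth; for \<open>q = 1\<close> it
  contains the standard flat function from which bumps are built.
\<close>

definition flat_exp :: "real poly \<Rightarrow> real \<Rightarrow> real"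
  where "flat_exp q t = (if t > 0 then poly q (1 / t) * exp (- (1 / t)) else 0)"

lemma flat_exp_tendsto_0: "((\<lambda>t. poly q (1 / t) * exp (- (1 / t))) \<longlongrightarrow> 0) (at_right (0::real))"
proof -
  have "((\<lambda>s. poly q s * exp (- s)) \<longlongrightarrow> 0) (at_top :: real filter)"
  proof -
    have "((\<lambda>s. \<Sum>i\<le>degree q. coeff q i * (s ^ i / exp s)) \<longlongrightarrow> (\<Sum>i\<le>degree q. coeff q i * 0)) at_top"
      by (intro tendsto_intros tendsto_power_div_exp_0)
    then show ?thesis
      by (simp add: poly_altdef sum_distrib_right exp_minus field_simps sum_divide_distrib)
  qed
  moreover have "filterlim (\<lambda>t. 1 / t) at_top (at_right (0::real))"
    using filterlim_inverse_at_top_right by (simp add: inverse_eq_divide)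
  ultimately show ?thesis
    by (rule filterlim_compose)
qed

lemma flat_exp_deriv:
  "(flat_exp q has_real_derivative flat_exp ([:0, 0, 1:] * (q - pderiv q)) t) (at t)"
proof -
  consider "t > 0" | "t < 0" | "t = 0" by linarith
  then show ?thesis
  proof cases
    case 1
    have "((\<lambda>t. poly q (1 / t) * exp (- (1 / t))) has_real_derivative
        flat_exp ([:0, 0, 1:] * (q - pderiv q)) t) (at t)"
      using 1 by (auto intro!: derivative_eq_intros DERIV_chain'[OF _ poly_DERIV]
          simp: flat_exp_def field_simps power2_eq_square)
    then show ?thesis
      by (rule has_field_derivative_transform_within_open[where S = "{0<..}"])
        (use 1 in \<open>auto simp: flat_exp_def\<close>)
  next
    case 2
    have "((\<lambda>t. 0) has_real_derivative flat_exp ([:0, 0, 1:] * (q - pderiv q)) t) (at t)"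
      using 2 by (simp add: flat_exp_def)
    then show ?thesis
      by (rule has_field_derivative_transform_within_open[where S = "{..<0}"])
        (use 2 in \<open>auto simp: flat_exp_def\<close>)
  next
    case 3
    \<comment> \<open>On the right, dividing by \<open>h\<close> amounts to multiplying the polynomial by its variable.\<close>
    have "((\<lambda>h. (flat_exp q h - flat_exp q 0) / h) \<longlongrightarrow> 0) (at 0)"
    proof (rule filterlim_split_at)
      show "((\<lambda>h. (flat_exp q h - flat_exp q 0) / h) \<longlongrightarrow> 0) (at_left 0)"
        by (rule Lim_transform_eventually[OF tendsto_const])
          (auto simp: flat_exp_def eventually_at_filter)
      have "((\<lambda>t. poly ([:0, 1:] * q) (1 / t) * exp (- (1 / t))) \<longlongrightarrow> 0) (at_right (0::real))"
        by (rule flat_exp_tendsto_0)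
      then show "((\<lambda>h. (flat_exp q h - flat_exp q 0) / h) \<longlongrightarrow> 0) (at_right 0)"
        by (rule Lim_transform_eventually) (auto simp: flat_exp_def eventually_at_filter)
    qed
    then show ?thesis
      using 3 by (simp add: DERIV_def flat_exp_def)
  qed
qed

lemma smooth_flat_exp: "smooth_upto k (flat_exp q)"
  by (induction k arbitrary: q) (use flat_exp_deriv in auto)

text \<open>
  Positive exactly on the open interval from \<open>a\<close> to \<open>b\<close> (for \<open>n > 0\<close>). The dilation by \<open>n\<close> makes the
  bumps tend to the indicator function of that interval as \<open>n\<close> grows, because
  \<open>exp (- 1 / (n * s))\<close> tends to \<open>1\<close> for \<open>s > 0\<close>.
\<close>

definition bump :: "real \<Rightarrow> real \<Rightarrow> nat \<Rightarrow> real \<Rightarrow> real"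
  where "bump a b n t = flat_exp 1 (real n * (t - a)) * flat_exp 1 (real n * (b - t))"

lemma smooth_bump: "smooth_upto k (bump a b n)"
proof -
  have "smooth_upto k (\<lambda>t. flat_exp 1 (real n * t + (- real n * a)) * flat_exp 1 ((- real n) * t + real n * b))"
    by (intro smooth_upto_mult smooth_upto_affine smooth_flat_exp)
  then show ?thesis
    by (rule back_subst[where P="smooth_upto k"]) (auto simp: bump_def fun_eq_iff algebra_simps)
qed

lemma flat_exp_one_bounds: "0 \<le> flat_exp 1 t" "flat_exp 1 t \<le> 1" "flat_exp 1 t > 0 \<longleftrightarrow> t > 0"
  by (auto simp: flat_exp_def)

lemma bump_nonneg: "0 \<le> bump a b n t"
  by (simp add: bump_def flat_exp_one_bounds)

lemma bump_le_indicator: "bump a b n t \<le> indicator {a..b} t"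
proof (cases "t \<in> {a..b}")
  case True
  then show ?thesis by (simp add: bump_def mult_le_one flat_exp_one_bounds)
next
  case False
  then have "real n * (t - a) \<le> 0 \<or> real n * (b - t) \<le> 0"
    by (auto simp: mult_le_0_iff)
  then show ?thesis using False by (auto simp: bump_def flat_exp_def)
qed

lemma bump_pos: "n > 0 \<Longrightarrow> a < t \<Longrightarrow> t < b \<Longrightarrow> 0 < bump a b n t"
  by (simp add: bump_def flat_exp_one_bounds)

lemma bump_zero: "t \<notin> {a..b} \<Longrightarrow> bump a b n t = 0"
  using bump_le_indicator[of a b n t] bump_nonneg[of a b n t] by auto

lemma bump_tendsto:
  "(\<lambda>n. bump a b (Suc n) t) \<longlonglongrightarrow> indicator {a<..<b} t"
proof (cases "t \<in> {a<..<b}")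
  case True
  have lim: "(\<lambda>n. flat_exp 1 (real (Suc n) * s)) \<longlonglongrightarrow> 1" if "s > 0" for s
  proof -
    have "(\<lambda>n. exp (- (inverse (real (Suc n)) * (1 / s)))) \<longlonglongrightarrow> exp (- (0 * (1 / s)))"
      by (intro tendsto_intros LIMSEQ_inverse_real_of_nat)
    moreover have "real (Suc n) * s > 0" for n using that by simp
    ultimately show ?thesis by (simp add: flat_exp_def inverse_eq_divide del: of_nat_Suc)
  qed
  have "(\<lambda>n. bump a b (Suc n) t) \<longlonglongrightarrow> 1 * 1"
    unfolding bump_def by (intro tendsto_mult lim) (use True in auto)
  then show ?thesis using True by simp
next
  case False
  then have "bump a b (Suc n) t = 0" for n
    by (auto simp: bump_def flat_exp_def zero_less_mult_iff)
  with False show ?thesis by simp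
qed

lemma test_functionD:
  assumes "test_function \<phi>"
  shows "continuous_on UNIV \<phi>" "continuous_on UNIV (partial_x \<phi>)" "continuous_on UNIV (partial_y \<phi>)"
    "((\<lambda>t. \<phi> (t, y)) has_real_derivative partial_x \<phi> (x, y)) (at x)"
    "((\<lambda>t. \<phi> (x, t)) has_real_derivative partial_y \<phi> (x, y)) (at y)"
proof -
  have *: "Ck (Suc 0) \<phi>" using assms by (simp add: test_function_def del: Ck.simps)
  then show "continuous_on UNIV \<phi>" "continuous_on UNIV (partial_x \<phi>)" "continuous_on UNIV (partial_y \<phi>)"
    by auto
  have "(\<lambda>t. \<phi> (t, y)) differentiable at x" "(\<lambda>t. \<phi> (x, t)) differentiable at y"
    using * by auto
  then show "((\<lambda>t. \<phi> (t, y)) has_real_derivative partial_x \<phi> (x, y)) (at x)"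
    "((\<lambda>t. \<phi> (x, t)) has_real_derivative partial_y \<phi> (x, y)) (at y)"
    by (simp_all add: partial_x_def partial_y_def DERIV_deriv_iff_real_differentiable)
qed

text \<open>
  Partial derivatives vanish wherever the function vanishes in a neighbourhood, so they are
  continuous with compact support as well.
\<close>

lemma test_function_Linf:
  assumes "test_function \<phi>"
  shows "Linf \<phi>" "Linf (partial_x \<phi>)" "Linf (partial_y \<phi>)"
proof -
  obtain K where K: "compact K" and 0: "\<And>p. p \<notin> K \<Longrightarrow> \<phi> p = 0"
  proof
    show "compact (closure {p. \<phi> p \<noteq> 0})" using assms by (simp add: test_function_def)
    show "\<phi> p = 0" if "p \<notin> closure {p. \<phi> p \<noteq> 0}" for p
      using that closure_subset[of "{p. \<phi> p \<noteq> 0}"] by blast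
  qed
  have op: "open (- K)" using compact_imp_closed[OF K] by (rule open_Compl)
  have dx: "partial_x \<phi> p = 0" if "p \<notin> K" for p
  proof -
    have "open ((\<lambda>t. (t, snd p)) -` (- K))"
      by (intro open_vimage op continuous_intros)
    then have "((\<lambda>t. \<phi> (t, snd p)) has_real_derivative 0) (at (fst p))"
      by (rule has_field_derivative_transform_within_open[OF DERIV_const[of 0]]) (use 0 that in auto)
    then show ?thesis by (simp add: partial_x_def DERIV_imp_deriv)
  qed
  have dy: "partial_y \<phi> p = 0" if "p \<notin> K" for p
  proof -
    have "open ((\<lambda>t. (fst p, t)) -` (- K))"
      by (intro open_vimage op continuous_intros)
    then have "((\<lambda>t. \<phi> (fst p, t)) has_real_derivative 0) (at (snd p))"
      by (rule has_field_derivative_transform_within_open[OF DERIV_const[of 0]]) (use 0 that in auto)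
    then show ?thesis by (simp add: partial_y_def DERIV_imp_deriv)
  qed
  show "Linf \<phi>" "Linf (partial_x \<phi>)" "Linf (partial_y \<phi>)"
    using 0 dx dy test_functionD(1-3)[OF assms] by (auto intro!: Linf_continuous_compact[OF _ K])
qed

lemma test_function_Lipschitz:
  assumes "test_function \<phi>"
  shows "\<bar>\<phi> (x, y) - \<phi> (x', y')\<bar>
    \<le> norm_Linf (partial_x \<phi>) * \<bar>x - x'\<bar> + norm_Linf (partial_y \<phi>) * \<bar>y - y'\<bar>"
proof -
  note D = test_functionD[OF assms] and L = test_function_Linf[OF assms]
  have "norm (\<phi> (x, y) - \<phi> (x', y)) \<le> norm_Linf (partial_x \<phi>) * norm (x - x')"
    by (rule field_differentiable_bound[of UNIV "\<lambda>t. \<phi> (t, y)" "\<lambda>t. partial_x \<phi> (t, y)"])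
      (simp_all add: D(4) continuous_le_norm_Linf[OF D(2) L(2)])
  moreover have "norm (\<phi> (x', y) - \<phi> (x', y')) \<le> norm_Linf (partial_y \<phi>) * norm (y - y')"
    by (rule field_differentiable_bound[of UNIV "\<lambda>t. \<phi> (x', t)" "\<lambda>t. partial_y \<phi> (x', t)"])
      (simp_all add: D(5) continuous_le_norm_Linf[OF D(3) L(3)])
  ultimately show ?thesis by simp
qed

section \<open>Oscillation of functions with bounded weak derivatives\<close>

definition smooth_density :: "real \<Rightarrow> real \<Rightarrow> (real \<Rightarrow> real) \<Rightarrow> bool"
  where "smooth_density a b u \<longleftrightarrow>
    (\<forall>k. smooth_upto k u) \<and> (\<forall>t. 0 \<le> u t) \<and> (\<forall>t. t \<notin> {a..b} \<longrightarrow> u t = 0) \<and>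
    integrable lborel u \<and> (LINT t|lborel. u t) = 1"

lemma smooth_density_subset:
  "smooth_density a' b' u \<Longrightarrow> a \<le> a' \<Longrightarrow> b' \<le> b \<Longrightarrow> smooth_density a b u"
  unfolding smooth_density_def by auto

lemma smooth_density_primitive:
  assumes "smooth_density a b u" "a < b"
  obtains G where "\<And>t. (G has_real_derivative u t) (at t)" "\<And>t. 0 \<le> G t" "\<And>t. G t \<le> 1"
    "\<And>t. t \<le> a \<Longrightarrow> G t = 0" "\<And>t. b \<le> t \<Longrightarrow> G t = 1"
proof -
  have sm: "smooth_upto (Suc 0) u" and nn: "\<And>t. 0 \<le> u t" and z: "\<And>t. t \<notin> {a..b} \<Longrightarrow> u t = 0"
    and int1: "(LINT t|lborel. u t) = 1"
    using assms(1) by (auto simp: smooth_density_def simp del: smooth_upto.simps)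
  have cont: "isCont u t" for t
    using smooth_upto_continuous[OF sm, of UNIV] by (simp add: continuous_on_eq_continuous_at)
  obtain F where "\<And>t. (F has_real_derivative u t) (at t)"
    using einterval_antiderivative[of "-\<infinity>" "\<infinity>" u] cont
    by (auto simp: has_real_derivative_iff_has_vector_derivative)
  then have dG: "((\<lambda>t. F t - F a) has_real_derivative u t) (at t)" for t
    by (auto intro!: derivative_eq_intros)
  define G where "G = (\<lambda>t. F t - F a)"
  have dG: "(G has_real_derivative u t) (at t)" for t using dG by (simp add: G_def)
  have contG: "continuous_on S G" for S
    using dG DERIV_isCont continuous_at_imp_continuous_on by blast
  have "(LINT t|lborel. u t * indicator {a..b} t) = G b - G a"
    using assms(2) dG cont by (intro integral_FTC_Icc_real) auto
  moreover have "u t * indicator {a..b} t = u t" for t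
    using z[of t] by (auto simp: indicator_def)
  ultimately have "G b = 1" using int1 by (simp add: G_def)
  have 0: "G t = 0" if "t \<le> a" for t
  proof (cases "t = a")
    case False
    have "G a = G t"
      using False that by (intro DERIV_isconst_end[of t a G] contG DERIV_cong[OF dG] z) auto
    then show ?thesis by (simp add: G_def)
  qed (simp add: G_def)
  have 1: "G t = 1" if "b \<le> t" for t
  proof (cases "t = b")
    case False
    have "G t = G b"
      using False that by (intro DERIV_isconst_end[of b t G] contG DERIV_cong[OF dG] z) auto
    then show ?thesis using \<open>G b = 1\<close> by simp
  qed (simp add: \<open>G b = 1\<close>)
  have mono: "G s \<le> G t" if "s \<le> t" for s t
    using that dG nn by (intro DERIV_nonneg_imp_nondecreasing[OF that]) blast
  show thesis
    using mono[of "min t a" t for t] mono[of t "max t b" for t] 0 1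
    by (intro that[of G] dG) (metis min.cobounded1 min.cobounded2, metis max.cobounded1 max.cobounded2, auto)
qed

text \<open>
  Each density has a distribution function rising from \<open>0\<close> to \<open>1\<close> inside the interval. The two
  distribution functions coincide outside the interval, so their difference is a primitive with compact
  support.
\<close>

lemma smooth_density_difference_primitive:
  assumes "smooth_density a b u" "smooth_density a b u'" "a < b"
  obtains F where "\<And>k. smooth_upto k F" "deriv F = (\<lambda>t. u t - u' t)"
    "\<And>t. \<bar>F t\<bar> \<le> indicator {a..b} t"
proof -
  obtain G where G: "\<And>t. (G has_real_derivative u t) (at t)" "\<And>t. 0 \<le> G t" "\<And>t. G t \<le> 1"
    "\<And>t. t \<le> a \<Longrightarrow> G t = 0" "\<And>t. b \<le> t \<Longrightarrow> G t = 1"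
    using smooth_density_primitive[OF assms(1,3)] by blast
  obtain G' where G': "\<And>t. (G' has_real_derivative u' t) (at t)" "\<And>t. 0 \<le> G' t" "\<And>t. G' t \<le> 1"
    "\<And>t. t \<le> a \<Longrightarrow> G' t = 0" "\<And>t. b \<le> t \<Longrightarrow> G' t = 1"
    using smooth_density_primitive[OF assms(2,3)] by blast
  have d: "((\<lambda>t. G t - G' t) has_real_derivative u t - u' t) (at t)" for t
    using G(1) G'(1) by (auto intro!: derivative_eq_intros)
  have "smooth_upto k (\<lambda>t. u t + (-1) * u' t)" for k
    using assms(1,2) unfolding smooth_density_def by (intro smooth_upto_add smooth_upto_cmult) auto
  then have "smooth_upto k (\<lambda>t. u t - u' t)" for k by simp
  with d have "smooth_upto (Suc k) (\<lambda>t. G t - G' t)" for k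
    by (auto intro!: exI[of _ "\<lambda>t. u t - u' t"])
  then have 1: "smooth_upto k (\<lambda>t. G t - G' t)" for k
    by (rule smooth_upto_SucD)
  have 2: "deriv (\<lambda>t. G t - G' t) = (\<lambda>t. u t - u' t)"
    using d DERIV_imp_deriv by blast
  have 3: "\<bar>G t - G' t\<bar> \<le> indicator {a..b} t" for t
    using G(2,3)[of t] G'(2,3)[of t] G(4,5)[of t] G'(4,5)[of t] by (auto simp: indicator_def)
  show thesis using that[OF 1 2 3] .
qed

text \<open>
  The test function is the product of \<open>v\<close> and the compactly supported primitive \<open>F\<close> of \<open>u - u'\<close>; the
  bound \<open>b - a\<close> is the length of the interval that carries \<open>F\<close>.
\<close>

lemma weak_partial_x_change_density:
  assumes "weak_partial_x \<omega> \<omega>x" "Linf \<omega>" "Linf \<omega>x" "a < b"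
    and "smooth_density a b u" "smooth_density a b u'" "smooth_density c d v"
  shows "\<bar>(LINT p|lebesgue. \<omega> p * (u (fst p) * v (snd p))) - (LINT p|lebesgue. \<omega> p * (u' (fst p) * v (snd p)))\<bar>
    \<le> norm_Linf \<omega>x * (b - a)"
proof -
  obtain F where F: "\<And>k. smooth_upto k F" "deriv F = (\<lambda>t. u t - u' t)"
    "\<And>t. \<bar>F t\<bar> \<le> indicator {a..b} t"
    using smooth_density_difference_primitive[OF assms(5,6,4)] by blast
  have v: "\<And>k. smooth_upto k v" "\<And>t. 0 \<le> v t" "\<And>t. t \<notin> {c..d} \<Longrightarrow> v t = 0"
    "integrable lborel v" "(LINT t|lborel. v t) = 1"
    and u: "integrable lborel u" "integrable lborel u'"
    using assms(5,6,7) by (auto simp: smooth_density_def)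
  have F0: "F t = 0" if "t \<notin> {a..b}" for t using F(3)[of t] that by auto
  have test: "test_function (\<lambda>p. F (fst p) * v (snd p))"
    using F0 F(1) v by (intro test_function_tensor)
  have deriv: "partial_x (\<lambda>p. F (fst p) * v (snd p)) = (\<lambda>p. (u (fst p) - u' (fst p)) * v (snd p))"
    using partial_tensor(1)[OF F(1) v(1)] F(2) by simp
  have "(LINT p|lebesgue. \<omega> p * (u (fst p) * v (snd p))) - (LINT p|lebesgue. \<omega> p * (u' (fst p) * v (snd p)))
    = (LINT p|lebesgue. \<omega> p * partial_x (\<lambda>p. F (fst p) * v (snd p)) p)"
    unfolding deriv
    by (subst Bochner_Integration.integral_diff[symmetric])
      (auto intro!: integrable_Linf_mult assms tensor_integral u v simp: algebra_simps)
  also have "\<dots> = - (LINT p|lebesgue. \<omega>x p * (F (fst p) * v (snd p)))"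
    using assms(1) test by (simp add: weak_partial_x_def)
  also have "\<bar>\<dots>\<bar> \<le> norm_Linf \<omega>x * (LINT p|lebesgue. indicator {a..b} (fst p) * v (snd p))"
    unfolding abs_minus using F(3) v
    by (intro integral_Linf_mult_bound assms tensor_integral integrable_indicator_Icc)
      (auto simp: abs_mult intro!: mult_mono)
  also have "(LINT p|lebesgue. indicator {a..b} (fst p) * v (snd p)) = b - a"
    using assms(4) v by (subst tensor_integral) (auto intro: integrable_indicator_Icc)
  finally show ?thesis .
qed

lemma weak_partial_y_change_density:
  assumes "weak_partial_y \<omega> \<omega>y" "Linf \<omega>" "Linf \<omega>y" "c < d"
    and "smooth_density a b u" "smooth_density c d v" "smooth_density c d v'"
  shows "\<bar>(LINT p|lebesgue. \<omega> p * (u (fst p) * v (snd p))) - (LINT p|lebesgue. \<omega> p * (u (fst p) * v' (snd p)))\<bar>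
    \<le> norm_Linf \<omega>y * (d - c)"
proof -
  obtain F where F: "\<And>k. smooth_upto k F" "deriv F = (\<lambda>t. v t - v' t)"
    "\<And>t. \<bar>F t\<bar> \<le> indicator {c..d} t"
    using smooth_density_difference_primitive[OF assms(6,7,4)] by blast
  have u: "\<And>k. smooth_upto k u" "\<And>t. 0 \<le> u t" "\<And>t. t \<notin> {a..b} \<Longrightarrow> u t = 0"
    "integrable lborel u" "(LINT t|lborel. u t) = 1"
    and v: "integrable lborel v" "integrable lborel v'"
    using assms(5,6,7) by (auto simp: smooth_density_def)
  have F0: "F t = 0" if "t \<notin> {c..d}" for t using F(3)[of t] that by auto
  have test: "test_function (\<lambda>p. u (fst p) * F (snd p))"
    using F0 F(1) u by (intro test_function_tensor)
  have deriv: "partial_y (\<lambda>p. u (fst p) * F (snd p)) = (\<lambda>p. u (fst p) * (v (snd p) - v' (snd p)))"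
    using partial_tensor(2)[OF u(1) F(1)] F(2) by simp
  have "(LINT p|lebesgue. \<omega> p * (u (fst p) * v (snd p))) - (LINT p|lebesgue. \<omega> p * (u (fst p) * v' (snd p)))
    = (LINT p|lebesgue. \<omega> p * partial_y (\<lambda>p. u (fst p) * F (snd p)) p)"
    unfolding deriv
    by (subst Bochner_Integration.integral_diff[symmetric])
      (auto intro!: integrable_Linf_mult assms tensor_integral u v simp: algebra_simps)
  also have "\<dots> = - (LINT p|lebesgue. \<omega>y p * (u (fst p) * F (snd p)))"
    using assms(1) test by (simp add: weak_partial_y_def)
  also have "\<bar>\<dots>\<bar> \<le> norm_Linf \<omega>y * (LINT p|lebesgue. u (fst p) * indicator {c..d} (snd p))"
    unfolding abs_minus using F(3) u
    by (intro integral_Linf_mult_bound assms tensor_integral integrable_indicator_Icc)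
      (auto simp: abs_mult intro!: mult_mono)
  also have "(LINT p|lebesgue. u (fst p) * indicator {c..d} (snd p)) = d - c"
    using assms(4) u by (subst tensor_integral) (auto intro: integrable_indicator_Icc)
  finally show ?thesis .
qed

lemma integrable_bump: "integrable lborel (bump a b n)"
proof (rule Bochner_Integration.integrable_bound)
  show "integrable lborel (indicator {a..b} :: real \<Rightarrow> real)" by (rule integrable_indicator_Icc)
  have "continuous_on UNIV (bump a b n)" by (rule smooth_upto_continuous[OF smooth_bump])
  then show "bump a b n \<in> borel_measurable lborel" by (simp add: borel_measurable_continuous_onI)
  show "AE t in lborel. norm (bump a b n t) \<le> norm (indicator {a..b} t :: real)"
    using bump_le_indicator bump_nonneg by simp
qed

lemma bump_integral_tendsto:
  assumes "a < b"
  shows "(\<lambda>n. LINT t|lborel. bump a b (Suc n) t) \<longlonglongrightarrow> b - a"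
proof -
  have "(\<lambda>n. LINT t|lborel. bump a b (Suc n) t) \<longlonglongrightarrow> (LINT t|lborel. indicator {a<..<b} t)"
    by (rule integral_dominated_convergence[where w = "indicator {a..b}"])
      (use bump_tendsto bump_le_indicator bump_nonneg integrable_bump integrable_indicator_Icc in auto)
  then show ?thesis using assms by simp
qed

lemma bump_integral_pos:
  assumes "a < b" shows "0 < (LINT t|lborel. bump a b (Suc n) t)"
proof -
  have "(LINT t|lborel. bump a b (Suc n) t) \<noteq> 0"
  proof
    assume "(LINT t|lborel. bump a b (Suc n) t) = 0"
    then have "AE t in lborel. bump a b (Suc n) t = 0"
      using integral_nonneg_eq_0_iff_AE[OF integrable_bump] bump_nonneg by auto
    then have "AE t in lborel. t \<notin> {a<..<b}"
      by eventually_elim (use bump_pos[of "Suc n" a _ b] in force)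
    then have "emeasure lborel {a<..<b} = 0"
      by (subst (asm) AE_iff_measurable[of "{a<..<b}"]) auto
    then show False using assms by simp
  qed
  moreover have "0 \<le> (LINT t|lborel. bump a b (Suc n) t)" by (simp add: bump_nonneg)
  ultimately show ?thesis by simp
qed

lemma smooth_density_bump:
  assumes "a < b"
  shows "smooth_density a b (\<lambda>t. (1 / (LINT t|lborel. bump a b (Suc n) t)) * bump a b (Suc n) t)"
proof -
  have "smooth_upto k (\<lambda>t. (1 / (LINT t|lborel. bump a b (Suc n) t)) * bump a b (Suc n) t)" for k
    by (intro smooth_upto_cmult smooth_bump)
  then show ?thesis
    using bump_integral_pos[OF assms, of n] unfolding smooth_density_def
    by (auto simp: bump_nonneg bump_zero integrable_bump)
qed

text \<open>
  Dominated convergence for the numerator and for both normalising constants. Bumps tend to the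
  indicator functions of open intervals; the sides of the box form a null set.
\<close>

lemma bump_mean_tendsto:
  assumes "Linf \<omega>" "a < b" "c < d"
  shows "(\<lambda>n. LINT p|lebesgue. \<omega> p *
      ((1 / (LINT t|lborel. bump a b (Suc n) t) * bump a b (Suc n) (fst p)) *
       (1 / (LINT t|lborel. bump c d (Suc n) t) * bump c d (Suc n) (snd p))))
    \<longlonglongrightarrow> (LINT p:{a..b} \<times> {c..d}|lebesgue. \<omega> p) / ((b - a) * (d - c))"
proof -
  let ?R = "{a..b} \<times> {c..d}"
  have meas: "\<omega> \<in> borel_measurable lebesgue" using assms by (simp add: Linf_def)
  have ind: "integrable lebesgue (\<lambda>p. indicator {a..b} (fst p) * indicator {c..d} (snd p) :: real)"
    by (intro tensor_integral integrable_indicator_Icc)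
  have "(\<lambda>n. LINT p|lebesgue. \<omega> p * (bump a b (Suc n) (fst p) * bump c d (Suc n) (snd p)))
      \<longlonglongrightarrow> (LINT p|lebesgue. \<omega> p * (indicator {a..b} (fst p) * indicator {c..d} (snd p)))"
  proof (rule integral_dominated_convergence[where w = "\<lambda>p. \<bar>\<omega> p * (indicator {a..b} (fst p) * indicator {c..d} (snd p))\<bar>"])
    show "(\<lambda>p. \<omega> p * (indicator {a..b} (fst p) * indicator {c..d} (snd p))) \<in> borel_measurable lebesgue"
      using integrable_Linf_mult[OF assms(1) ind] by auto
    show "(\<lambda>p. \<omega> p * (bump a b (Suc n) (fst p) * bump c d (Suc n) (snd p))) \<in> borel_measurable lebesgue" for n
      using integrable_Linf_mult[OF assms(1) tensor_integral(1)[OF integrable_bump integrable_bump]] by auto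
    show "integrable lebesgue (\<lambda>p. \<bar>\<omega> p * (indicator {a..b} (fst p) * indicator {c..d} (snd p))\<bar>)"
      using integrable_Linf_mult[OF assms(1) ind] by (rule integrable_abs)
    show "AE p in lebesgue. (\<lambda>n. \<omega> p * (bump a b (Suc n) (fst p) * bump c d (Suc n) (snd p)))
        \<longlonglongrightarrow> \<omega> p * (indicator {a..b} (fst p) * indicator {c..d} (snd p))"
      using AE_lebesgue_coordinates_neq[of a c] AE_lebesgue_coordinates_neq[of b d]
    proof eventually_elim
      case (elim p)
      then have "indicator {a..b} (fst p) = (indicator {a<..<b} (fst p) :: real)"
        "indicator {c..d} (snd p) = (indicator {c<..<d} (snd p) :: real)"
        by (auto simp: indicator_def)
      then show ?case by (auto intro!: tendsto_mult tendsto_const bump_tendsto)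
    qed
    show "AE p in lebesgue. norm (\<omega> p * (bump a b (Suc n) (fst p) * bump c d (Suc n) (snd p)))
       \<le> \<bar>\<omega> p * (indicator {a..b} (fst p) * indicator {c..d} (snd p))\<bar>" for n
      by (auto simp: abs_mult bump_nonneg intro!: mult_left_mono mult_mono bump_le_indicator)
  qed
  moreover have "\<omega> p * (indicator {a..b} (fst p) * indicator {c..d} (snd p)) = indicator ?R p *\<^sub>R \<omega> p" for p
    by (auto simp: indicator_def mem_Times_iff)
  ultimately have lim: "(\<lambda>n. LINT p|lebesgue. \<omega> p * (bump a b (Suc n) (fst p) * bump c d (Suc n) (snd p)))
      \<longlonglongrightarrow> (LINT p:?R|lebesgue. \<omega> p)"
    by (simp add: set_lebesgue_integral_def)
  have "(\<lambda>n. (LINT p|lebesgue. \<omega> p * (bump a b (Suc n) (fst p) * bump c d (Suc n) (snd p))) /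
        ((LINT t|lborel. bump a b (Suc n) t) * (LINT t|lborel. bump c d (Suc n) t)))
      \<longlonglongrightarrow> (LINT p:?R|lebesgue. \<omega> p) / ((b - a) * (d - c))"
    using assms by (intro tendsto_divide lim tendsto_mult bump_integral_tendsto) auto
  then show ?thesis
    by (simp add: field_simps flip: integral_divide_zero)
qed

text \<open>
  The densities of the smaller box are also densities on the larger one, so two exchanges, one in
  each coordinate, lead from the one average to the other; the bound passes to the limit.
\<close>

lemma weak_derivative_box_means:
  assumes "Linf \<omega>" "weak_partial_x \<omega> \<omega>x" "Linf \<omega>x" "weak_partial_y \<omega> \<omega>y" "Linf \<omega>y"
    and "a \<le> a'" "a' < b'" "b' \<le> b" "c \<le> c'" "c' < d'" "d' \<le> d"
  shows "\<bar>(LINT p:{a'..b'} \<times> {c'..d'}|lebesgue. \<omega> p) / ((b' - a') * (d' - c'))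
      - (LINT p:{a..b} \<times> {c..d}|lebesgue. \<omega> p) / ((b - a) * (d - c))\<bar>
    \<le> norm_Linf \<omega>x * (b - a) + norm_Linf \<omega>y * (d - c)"
proof -
  define \<beta> where "\<beta> a b n t = (1 / (LINT t|lborel. bump a b (Suc n) t)) * bump a b (Suc n) t" for a b n t
  define I where "I u v = (LINT p|lebesgue. \<omega> p * (u (fst p) * v (snd p)))" for u v :: "real \<Rightarrow> real"
  have "\<bar>I (\<beta> a' b' n) (\<beta> c' d' n) - I (\<beta> a b n) (\<beta> c d n)\<bar> \<le> norm_Linf \<omega>x * (b - a) + norm_Linf \<omega>y * (d - c)" for n
  proof -
    have "smooth_density a' b' (\<beta> a' b' n)" "smooth_density c' d' (\<beta> c' d' n)"
      "smooth_density a b (\<beta> a b n)" "smooth_density c d (\<beta> c d n)"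
      using smooth_density_bump[of a' b' n] smooth_density_bump[of c' d' n]
        smooth_density_bump[of a b n] smooth_density_bump[of c d n] assms by (auto simp: \<beta>_def[abs_def])
    moreover from this have "smooth_density a b (\<beta> a' b' n)" "smooth_density c d (\<beta> c' d' n)"
      using assms smooth_density_subset by blast+
    ultimately have "\<bar>I (\<beta> a' b' n) (\<beta> c' d' n) - I (\<beta> a b n) (\<beta> c' d' n)\<bar> \<le> norm_Linf \<omega>x * (b - a)"
      "\<bar>I (\<beta> a b n) (\<beta> c' d' n) - I (\<beta> a b n) (\<beta> c d n)\<bar> \<le> norm_Linf \<omega>y * (d - c)"
      unfolding I_def using assms by (auto intro!: weak_partial_x_change_density weak_partial_y_change_density)
    then show ?thesis by linarith
  qed
  moreover have "(\<lambda>n. I (\<beta> a' b' n) (\<beta> c' d' n)) \<longlonglongrightarrow> (LINT p:{a'..b'} \<times> {c'..d'}|lebesgue. \<omega> p) / ((b' - a') * (d' - c'))"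
    unfolding I_def \<beta>_def using assms by (intro bump_mean_tendsto)
  moreover have "(\<lambda>n. I (\<beta> a b n) (\<beta> c d n)) \<longlonglongrightarrow> (LINT p:{a..b} \<times> {c..d}|lebesgue. \<omega> p) / ((b - a) * (d - c))"
    unfolding I_def \<beta>_def using assms by (intro bump_mean_tendsto) auto
  ultimately show ?thesis
    by (intro LIMSEQ_le_const2[OF tendsto_rabs[OF tendsto_diff]]) auto
qed

text \<open>
  Almost every point is the limit of the means of \<open>\<omega>\<close> over small squares having that point as lower left
  corner. For a point of the half-open box these squares eventually lie in the closed box, where
  \<open>weak_derivative_box_means\<close> applies.
\<close>

lemma weak_derivative_bounded_oscillation:
  assumes "Linf \<omega>" "weak_partial_x \<omega> \<omega>x" "Linf \<omega>x" "weak_partial_y \<omega> \<omega>y" "Linf \<omega>y"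
  shows "AE p in lebesgue. p \<in> {a..<b} \<times> {c..<d} \<longrightarrow>
    \<bar>\<omega> p - (LINT p:{a..b} \<times> {c..d}|lebesgue. \<omega> p) / ((b - a) * (d - c))\<bar>
      \<le> norm_Linf \<omega>x * (b - a) + norm_Linf \<omega>y * (d - c)"
proof -
  let ?W = "(LINT p:{a..b} \<times> {c..d}|lebesgue. \<omega> p) / ((b - a) * (d - c))"
  let ?K = "norm_Linf \<omega>x * (b - a) + norm_Linf \<omega>y * (d - c)"
  have int: "\<omega> integrable_on cbox p q" for p q
    using set_integrable_Linf[OF assms(1), of "cbox p q"]
    by (intro set_lebesgue_integral_eq_integral) auto
  obtain N where N: "negligible N" and lim: "\<And>x e. \<lbrakk>x \<notin> N; 0 < e\<rbrakk> \<Longrightarrow>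
      \<exists>d>0. \<forall>h. 0 < h \<and> h < d \<longrightarrow> norm(integral (cbox x (x + h *\<^sub>R One)) \<omega> /\<^sub>R h ^ DIM(real \<times> real) - \<omega> x) < e"
    using integrable_ccontinuous_explicit[OF int] by blast
  from N have "AE p in lebesgue. p \<notin> N"
    by (intro AE_not_in) (simp add: negligible_iff_null_sets)
  then show ?thesis
  proof eventually_elim
    case (elim p)
    show ?case
    proof
      assume p: "p \<in> {a..<b} \<times> {c..<d}"
      obtain x y where xy: "p = (x, y)" by (cases p)
      show "\<bar>\<omega> p - ?W\<bar> \<le> ?K"
      proof (rule field_le_epsilon)
        fix e :: real assume "0 < e"
        from lim[OF elim this] obtain \<delta> where \<delta>: "\<delta> > 0"
          "\<And>h. 0 < h \<Longrightarrow> h < \<delta> \<Longrightarrow> norm (integral (cbox p (p + h *\<^sub>R One)) \<omega> /\<^sub>R h ^ DIM(real \<times> real) - \<omega> p) < e"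
          by blast
        \<comment> \<open>Small enough for the differentiation theorem and for the square to stay in the box.\<close>
        define h where "h = min (\<delta> / 2) (min (b - x) (d - y))"
        have h: "0 < h" "h < \<delta>" "x + h \<le> b" "y + h \<le> d" "a \<le> x" "c \<le> y"
          using p \<delta>(1) by (auto simp: h_def xy)
        have "cbox p (p + h *\<^sub>R One) = {x..x + h} \<times> {y..y + h}"
          by (auto simp: xy cbox_def Basis_prod_def)
        moreover have "integral (cbox p (p + h *\<^sub>R One)) \<omega> = (LINT p:cbox p (p + h *\<^sub>R One)|lebesgue. \<omega> p)"
          by (intro set_lebesgue_integral_eq_integral(2)[symmetric] set_integrable_Linf assms) auto
        ultimately have "integral (cbox p (p + h *\<^sub>R One)) \<omega> /\<^sub>R h ^ DIM(real \<times> real)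
            = (LINT p:{x..x + h} \<times> {y..y + h}|lebesgue. \<omega> p) / ((x + h - x) * (y + h - y))"
          by (simp add: divide_inverse mult.commute power2_eq_square)
        with \<delta>(2)[OF h(1,2)]
        have "\<bar>(LINT p:{x..x + h} \<times> {y..y + h}|lebesgue. \<omega> p) / ((x + h - x) * (y + h - y)) - \<omega> p\<bar> < e"
          by simp
        moreover have "\<bar>(LINT p:{x..x + h} \<times> {y..y + h}|lebesgue. \<omega> p) / ((x + h - x) * (y + h - y)) - ?W\<bar> \<le> ?K"
          using h by (intro weak_derivative_box_means assms) auto
        ultimately show "\<bar>\<omega> p - ?W\<bar> \<le> ?K + e" by linarith
      qed
    qed
  qed
qed

section \<open>Averages against a test function on one cell\<close>

text \<open>
  With \<open>a\<close> the mean of \<open>\<rho>\<close> on \<open>S\<close>, the left-hand side is the integral of \<open>(a - \<rho>) * \<phi>\<close>. As \<open>a - \<rho>\<close> has integral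
  zero, \<open>\<phi>\<close> can be replaced by \<open>\<phi> - c\<close>. The factor \<open>2\<close> comes from \<open>\<bar>a - \<rho>\<bar> \<le> a + \<rho>\<close>, where both summands have the
  same integral.
\<close>

lemma mean_defect_bound:
  fixes \<rho> \<phi> :: "'a \<Rightarrow> real"
  assumes S: "S \<in> sets M" "emeasure M S < \<infinity>" "measure M S \<noteq> 0"
    and \<rho>: "set_integrable M S \<rho>" "AE p in M. p \<in> S \<longrightarrow> 0 \<le> \<rho> p"
    and \<phi>: "\<phi> \<in> borel_measurable M" "\<And>p. p \<in> S \<Longrightarrow> \<bar>\<phi> p - c\<bar> \<le> \<delta>"
  shows "\<bar>(LINT p:S|M. \<rho> p) / measure M S * (LINT p:S|M. \<phi> p) - (LINT p:S|M. \<rho> p * \<phi> p)\<bar>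
    \<le> 2 * \<delta> * (LINT p:S|M. \<rho> p)"
proof -
  define a where "a = (LINT p:S|M. \<rho> p) / measure M S"
  have a0: "0 \<le> a"
    unfolding a_def set_lebesgue_integral_def
    by (intro divide_nonneg_nonneg integral_nonneg_AE) (use \<rho>(2) in \<open>auto simp: indicator_def\<close>)
  have aint: "set_integrable M S (\<lambda>p. k)" for k :: real
    unfolding set_integrable_def using S by (intro integrable_scaleR_left integrable_real_indicator)
  have bnd: "\<bar>\<phi> p\<bar> \<le> \<bar>c\<bar> + \<delta>" if "p \<in> S" for p using \<phi>(2)[OF that] by linarith
  have mult: "set_integrable M S (\<lambda>p. f p * \<phi> p)" if f: "set_integrable M S f" for f
    unfolding set_integrable_def
  proof (rule Bochner_Integration.integrable_bound)
    show "integrable M (\<lambda>p. (\<bar>c\<bar> + \<delta>) * (indicator S p *\<^sub>R f p))"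
      using f by (simp add: set_integrable_def)
    have "(\<lambda>p. indicator S p *\<^sub>R f p) \<in> borel_measurable M"
      using f by (auto simp: set_integrable_def)
    then have "(\<lambda>p. (indicator S p *\<^sub>R f p) * \<phi> p) \<in> borel_measurable M"
      using \<phi>(1) by (rule borel_measurable_times)
    then show "(\<lambda>p. indicator S p *\<^sub>R (f p * \<phi> p)) \<in> borel_measurable M"
      by (simp add: mult.assoc)
    show "AE p in M. norm (indicator S p *\<^sub>R (f p * \<phi> p)) \<le> norm ((\<bar>c\<bar> + \<delta>) * (indicator S p *\<^sub>R f p))"
    proof (rule AE_I2)
      fix p show "norm (indicator S p *\<^sub>R (f p * \<phi> p)) \<le> norm ((\<bar>c\<bar> + \<delta>) * (indicator S p *\<^sub>R f p))"
      proof (cases "p \<in> S")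
        case True
        have "\<bar>\<phi> p\<bar> * \<bar>f p\<bar> \<le> \<bar>\<bar>c\<bar> + \<delta>\<bar> * \<bar>f p\<bar>"
          using bnd[OF True] by (intro mult_right_mono) auto
        then show ?thesis using True by (simp add: abs_mult mult.commute)
      qed simp
    qed
  qed
  have "a * (LINT p:S|M. \<phi> p) - (LINT p:S|M. \<rho> p * \<phi> p) = (LINT p:S|M. a * \<phi> p - \<rho> p * \<phi> p)"
    using mult[OF aint[of a]] mult[OF \<rho>(1)] by (simp add: set_integral_diff)
  also have "\<dots> = (LINT p:S|M. a * \<phi> p - \<rho> p * \<phi> p) - c * (LINT p:S|M. a - \<rho> p)"
  proof -
    have "(LINT p:S|M. a - \<rho> p) = (LINT p:S|M. a) - (LINT p:S|M. \<rho> p)"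
      using aint \<rho>(1) by (simp add: set_integral_diff)
    also have "(LINT p:S|M. a) = a * measure M S"
      using S by (simp add: set_lebesgue_integral_def)
    finally show ?thesis using S by (simp add: a_def)
  qed
  also have "\<dots> = (LINT p:S|M. (a * \<phi> p - \<rho> p * \<phi> p) - c * (a - \<rho> p))"
  proof -
    have "set_integrable M S (\<lambda>p. a * \<phi> p - \<rho> p * \<phi> p)"
      using mult[OF aint[of a]] mult[OF \<rho>(1)] by (rule set_integral_diff)
    moreover have "set_integrable M S (\<lambda>p. c * (a - \<rho> p))"
      using set_integral_diff(1)[OF aint[of a] \<rho>(1)] by simp
    ultimately show ?thesis by (simp add: set_integral_diff(2))
  qed
  also have "\<bar>\<dots>\<bar> \<le> (LINT p:S|M. \<bar>(a * \<phi> p - \<rho> p * \<phi> p) - c * (a - \<rho> p)\<bar>)"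
    unfolding set_lebesgue_integral_def
    by (rule order_trans[OF integral_abs_bound]) (simp add: abs_mult)
  also have "\<dots> \<le> (LINT p:S|M. \<delta> * (a + \<rho> p))"
    unfolding set_lebesgue_integral_def
  proof (rule integral_mono_AE')
    show "integrable M (\<lambda>p. indicator S p *\<^sub>R (\<delta> * (a + \<rho> p)))"
      using set_integral_add(1)[OF aint[of a] \<rho>(1)]
      unfolding set_integrable_def[symmetric] by (intro set_integrable_mult_right)
    have key: "\<bar>(a * \<phi> p - \<rho> p * \<phi> p) - c * (a - \<rho> p)\<bar> \<le> \<delta> * (a + \<rho> p)" 
      if "p \<in> S" "0 \<le> \<rho> p" for p
    proof -
      have "(a * \<phi> p - \<rho> p * \<phi> p) - c * (a - \<rho> p) = (\<phi> p - c) * (a - \<rho> p)" by (simp add: algebra_simps)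
      also have "\<bar>\<dots>\<bar> \<le> \<delta> * (a + \<rho> p)"
        unfolding abs_mult using \<phi>(2)[OF that(1)] that(2) a0 by (intro mult_mono) auto
      finally show ?thesis .
    qed
    show "AE p in M. indicator S p *\<^sub>R \<bar>(a * \<phi> p - \<rho> p * \<phi> p) - c * (a - \<rho> p)\<bar> \<le> indicator S p *\<^sub>R (\<delta> * (a + \<rho> p))"
      using \<rho>(2) by eventually_elim (use key in \<open>auto simp: indicator_def\<close>)
    show "AE p in M. 0 \<le> indicator S p *\<^sub>R (\<delta> * (a + \<rho> p))"
      using \<rho>(2)
    proof eventually_elim
      case (elim p)
      then show ?case using \<phi>(2)[of p] a0 by (auto simp: indicator_def intro!: mult_nonneg_nonneg)
    qed
  qed
  also have "\<dots> = \<delta> * (a * measure M S + (LINT p:S|M. \<rho> p))"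
    using set_integral_add(2)[OF aint[of a] \<rho>(1)] S by (simp add: set_lebesgue_integral_def)
  also have "\<dots> = 2 * \<delta> * (LINT p:S|M. \<rho> p)"
    using S by (simp add: a_def)
  finally show ?thesis by (simp add: a_def)
qed

section \<open>Summation over the grid\<close>

locale rectangular_grid =
  fixes L1 L1' L2 L2' :: real and N :: nat
  assumes L1: "L1' < L1" and L2: "L2' < L2" and N: "1 \<le> N"
begin

definition h1 :: real where "h1 = (L1 - L1') / N"
definition h2 :: real where "h2 = (L2 - L2') / N"

abbreviation x :: "nat \<Rightarrow> real" where "x \<equiv> grid L1' L1 N"
abbreviation y :: "nat \<Rightarrow> real" where "y \<equiv> grid L2' L2 N"

definition cell :: "nat \<Rightarrow> nat \<Rightarrow> (real \<times> real) set"
  where "cell i j = {x i..<x (Suc i)} \<times> {y j..<y (Suc j)}"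

lemma h_pos: "0 < h1" "0 < h2"
  using L1 L2 N by (auto simp: h1_def h2_def)

lemma x_Suc: "x (Suc i) = x i + h1" and y_Suc: "y (Suc j) = y j + h2"
  by (simp_all add: grid_def h1_def h2_def algebra_simps add_divide_distrib diff_divide_distrib)

lemma grid_ends: "x 0 = L1'" "x N = L1" "y 0 = L2'" "y N = L2"
  using N by (auto simp: grid_def)

lemma grid_mono: "mono x" "mono y"
  using h_pos by (auto intro!: mono_iff_le_Suc[THEN iffD2] simp: x_Suc y_Suc)

lemma cell_measurable: "cell i j \<in> sets lebesgue" "emeasure lebesgue (cell i j) < \<infinity>"
  and measure_cell: "measure lebesgue (cell i j) = h1 * h2"
  using half_open_box[of "x i" "x (Suc i)" "y j" "y (Suc j)"] h_pos
  by (auto simp: cell_def x_Suc y_Suc fmeasurable_def)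

lemma cell_mean_eq:
  assumes "set_integrable lebesgue ({x i..x (Suc i)} \<times> {y j..y (Suc j)}) f"
  shows "cell_mean L1 L1' L2 L2' f N i j = (LINT p:cell i j|lebesgue. f p) / measure lebesgue (cell i j)"
    and "cell_mean L1 L1' L2 L2' f N i j
      = (LINT p:{x i..x (Suc i)} \<times> {y j..y (Suc j)}|lebesgue. f p) / ((x (Suc i) - x i) * (y (Suc j) - y j))"
proof -
  have "(real N)\<^sup>2 / ((L1 - L1') * (L2 - L2')) = 1 / (h1 * h2)"
    by (simp add: h1_def h2_def power2_eq_square)
  moreover have "x (Suc i) - x i = h1" "y (Suc j) - y j = h2"
    by (simp_all add: x_Suc y_Suc)
  ultimately show "cell_mean L1 L1' L2 L2' f N i j
      = (LINT p:{x i..x (Suc i)} \<times> {y j..y (Suc j)}|lebesgue. f p) / ((x (Suc i) - x i) * (y (Suc j) - y j))"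
    by (simp only: cell_mean_def set_lebesgue_Fubini[OF assms]) simp
  then show "cell_mean L1 L1' L2 L2' f N i j = (LINT p:cell i j|lebesgue. f p) / measure lebesgue (cell i j)"
    using measure_cell[of i j] set_integral_closed_box_half_open[OF assms]
    by (simp add: cell_def x_Suc y_Suc)
qed

text \<open>
  The half-open cells tile the half-open rectangle, which differs from the closed one by a null set.
\<close>

lemma sum_indicator_cell:
  "(\<Sum>i<N. \<Sum>j<N. indicator (cell i j) p) = (indicator ({L1'..<L1} \<times> {L2'..<L2}) p :: real)"
proof -
  have "(\<Sum>i<N. \<Sum>j<N. indicator (cell i j) p) =
      (\<Sum>i<N. indicator {x i..<x (Suc i)} (fst p)) * (\<Sum>j<N. indicator {y j..<y (Suc j)} (snd p) :: real)"
    unfolding sum_product by (intro sum.cong refl) (auto simp: cell_def indicator_def mem_Times_iff)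
  then show ?thesis
    by (simp add: sum_indicator_consecutive grid_mono grid_ends) (auto simp: indicator_def mem_Times_iff)
qed

lemma integral_eq_sum_cells:
  fixes F :: "real \<times> real \<Rightarrow> real"
  assumes "integrable lebesgue F" "AE p in lebesgue. p \<notin> {L1'..L1} \<times> {L2'..L2} \<longrightarrow> F p = 0"
  shows "(LINT p|lebesgue. F p) = (\<Sum>i<N. \<Sum>j<N. LINT p:cell i j|lebesgue. F p)"
proof -
  define G where "G i j p = indicator (cell i j) p *\<^sub>R F p" for i j p
  have int: "integrable lebesgue (G i j)" for i j
    using set_integrable_of_integrable[OF assms(1) cell_measurable(1)]
    by (simp add: set_integrable_def G_def[abs_def])
  have "AE p in lebesgue. F p = (\<Sum>i<N. \<Sum>j<N. G i j p)"
    using assms(2) AE_lebesgue_coordinates_neq[of L1 L2]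
  proof eventually_elim
    case (elim p)
    have "(\<Sum>i<N. \<Sum>j<N. G i j p) = (indicator ({L1'..<L1} \<times> {L2'..<L2}) p * F p)"
      unfolding G_def real_scaleR_def sum_distrib_right[symmetric] sum_indicator_cell ..
    with elim show ?case by (cases p) (auto simp: indicator_def)
  qed
  then have "(LINT p|lebesgue. F p) = (LINT p|lebesgue. (\<Sum>i<N. \<Sum>j<N. G i j p))"
    using assms(1) int by (intro integral_cong_AE) auto
  also have "\<dots> = (\<Sum>i<N. \<Sum>j<N. LINT p:cell i j|lebesgue. F p)"
    using int unfolding set_lebesgue_integral_def G_def[symmetric] by simp
  finally show ?thesis .
qed

lemma integral_piecewise_const:
  fixes \<phi> :: "real \<times> real \<Rightarrow> real"
  assumes "integrable lebesgue \<phi>"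
  shows "(LINT p|lebesgue. piecewise_const L1 L1' L2 L2' N c p * \<phi> p)
    = (\<Sum>i<N. \<Sum>j<N. c i j * (LINT p:cell i j|lebesgue. \<phi> p))"
proof -
  define G where "G i j p = indicator (cell i j) p *\<^sub>R \<phi> p" for i j p
  have int: "integrable lebesgue (G i j)" for i j
    using set_integrable_of_integrable[OF assms cell_measurable(1)]
    by (simp add: set_integrable_def G_def[abs_def])
  have "piecewise_const L1 L1' L2 L2' N c p * \<phi> p = (\<Sum>i<N. \<Sum>j<N. c i j * G i j p)" for p
    unfolding piecewise_const_def sum_distrib_right G_def
    by (intro sum.cong refl) (auto simp: cell_def indicator_def mem_Times_iff)
  moreover have "(LINT p:cell i j|lebesgue. \<phi> p) = (LINT p|lebesgue. G i j p)" for i j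
    by (simp add: set_lebesgue_integral_def G_def)
  ultimately show ?thesis
    using int by simp
qed

text \<open>
  Reduces both error estimates to a single cell: a bound proportional to the mass of \<open>\<rho>\<close> in the cell
  adds up to a bound proportional to the total mass. It is used with \<open>F = \<rho> * \<phi>\<close> and with
  \<open>F = \<rho> * \<omega> * \<phi>\<close>.
\<close>

lemma integral_piecewise_const_diff_bound:
  assumes "integrable lebesgue \<phi>" "integrable lebesgue F" "integrable lebesgue \<rho>"
    and "AE p in lebesgue. p \<notin> {L1'..L1} \<times> {L2'..L2} \<longrightarrow> \<rho> p = 0"
    and "AE p in lebesgue. \<rho> p = 0 \<longrightarrow> F p = 0"
    and "\<And>i j. \<bar>c i j * (LINT p:cell i j|lebesgue. \<phi> p) - (LINT p:cell i j|lebesgue. F p)\<bar>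
      \<le> C * (LINT p:cell i j|lebesgue. \<rho> p)"
  shows "\<bar>(LINT p|lebesgue. piecewise_const L1 L1' L2 L2' N c p * \<phi> p) - (LINT p|lebesgue. F p)\<bar>
    \<le> C * (LINT p|lebesgue. \<rho> p)"
proof -
  have "AE p in lebesgue. p \<notin> {L1'..L1} \<times> {L2'..L2} \<longrightarrow> F p = 0"
    using assms(4,5) by eventually_elim blast
  then have "(LINT p|lebesgue. piecewise_const L1 L1' L2 L2' N c p * \<phi> p) - (LINT p|lebesgue. F p)
    = (\<Sum>i<N. \<Sum>j<N. c i j * (LINT p:cell i j|lebesgue. \<phi> p) - (LINT p:cell i j|lebesgue. F p))"
    using assms(1,2) by (simp add: integral_piecewise_const integral_eq_sum_cells sum_subtractf)
  also have "\<bar>\<dots>\<bar> \<le> (\<Sum>i<N. \<Sum>j<N. C * (LINT p:cell i j|lebesgue. \<rho> p))"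
    by (intro order_trans[OF sum_abs] sum_mono assms(6))
  also have "\<dots> = C * (LINT p|lebesgue. \<rho> p)"
    by (simp add: integral_eq_sum_cells[OF assms(3,4)] sum_distrib_left)
  finally show ?thesis .
qed

lemma density_cell_bound:
  assumes "test_function \<phi>" "integrable lebesgue \<rho>" "AE p in lebesgue. 0 \<le> \<rho> p"
  shows "\<bar>cell_mean L1 L1' L2 L2' \<rho> N i j * (LINT p:cell i j|lebesgue. \<phi> p) - (LINT p:cell i j|lebesgue. \<rho> p * \<phi> p)\<bar>
    \<le> 2 * (norm_Linf (partial_x \<phi>) * h1 + norm_Linf (partial_y \<phi>) * h2) * (LINT p:cell i j|lebesgue. \<rho> p)"
proof -
  have "set_integrable lebesgue ({x i..x (Suc i)} \<times> {y j..y (Suc j)}) \<rho>"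
    by (intro set_integrable_of_integrable assms fmeasurableD closed_box_lmeasurable)
  note mean = cell_mean_eq(1)[OF this]
  show ?thesis unfolding mean
  proof (rule mean_defect_bound[where c = "\<phi> (x i, y j)"])
    show "cell i j \<in> sets lebesgue" "emeasure lebesgue (cell i j) < \<infinity>" by (rule cell_measurable)+
    show "measure lebesgue (cell i j) \<noteq> 0" using h_pos by (simp add: measure_cell)
    show "set_integrable lebesgue (cell i j) \<rho>"
      by (intro set_integrable_of_integrable assms cell_measurable)
    show "AE p in lebesgue. p \<in> cell i j \<longrightarrow> 0 \<le> \<rho> p"
      using assms(3) by eventually_elim simp
    show "\<phi> \<in> borel_measurable lebesgue"
      using test_function_Linf(1)[OF assms(1)] by (simp add: Linf_def)
    fix p assume p: "p \<in> cell i j"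
    obtain s t where st: "p = (s, t)" by (cases p)
    have "\<bar>\<phi> p - \<phi> (x i, y j)\<bar> \<le> norm_Linf (partial_x \<phi>) * \<bar>s - x i\<bar> + norm_Linf (partial_y \<phi>) * \<bar>t - y j\<bar>"
      unfolding st by (rule test_function_Lipschitz[OF assms(1)])
    also have "\<dots> \<le> norm_Linf (partial_x \<phi>) * h1 + norm_Linf (partial_y \<phi>) * h2"
      using p test_function_Linf[OF assms(1)]
      by (intro add_mono mult_left_mono norm_Linf_nonneg) (auto simp: st cell_def x_Suc y_Suc)
    finally show "\<bar>\<phi> p - \<phi> (x i, y j)\<bar> \<le> norm_Linf (partial_x \<phi>) * h1 + norm_Linf (partial_y \<phi>) * h2" .
  qed
qed

lemma cell_mean_bound:
  assumes "Linf \<omega>"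
  shows "\<bar>cell_mean L1 L1' L2 L2' \<omega> N i j\<bar> \<le> norm_Linf \<omega>"
proof -
  have "set_integrable lebesgue ({x i..x (Suc i)} \<times> {y j..y (Suc j)}) \<omega>"
    by (intro set_integrable_Linf assms closed_box_lmeasurable)
  note mean = cell_mean_eq(1)[OF this]
  have "\<bar>LINT p:cell i j|lebesgue. \<omega> p\<bar> = \<bar>LINT p|lebesgue. \<omega> p * indicator (cell i j) p\<bar>"
    by (simp add: set_lebesgue_integral_def mult.commute)
  also have "\<dots> \<le> norm_Linf \<omega> * (LINT p|lebesgue. indicator (cell i j) p)"
    using cell_measurable by (intro integral_Linf_mult_bound assms integrable_real_indicator) auto
  also have "\<dots> = norm_Linf \<omega> * measure lebesgue (cell i j)"
    using cell_measurable(1) by simp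
  finally show ?thesis
    unfolding mean using h_pos by (simp add: measure_cell field_simps)
qed

text \<open>
  Splits \<open>a * W - \<rho> * \<omega>\<close> into \<open>W * (a - \<rho>)\<close>, treated by \<open>density_cell_bound\<close>, and \<open>\<rho> * (W - \<omega>)\<close>,
  controlled by the oscillation of \<open>\<omega>\<close> on the cell.
\<close>

lemma density_velocity_cell_bound:
  assumes \<phi>: "test_function \<phi>" and \<rho>: "integrable lebesgue \<rho>" "AE p in lebesgue. 0 \<le> \<rho> p"
    and \<omega>: "Linf \<omega>" "weak_partial_x \<omega> \<omega>x" "Linf \<omega>x" "weak_partial_y \<omega> \<omega>y" "Linf \<omega>y"
  shows "\<bar>cell_mean L1 L1' L2 L2' \<rho> N i j * cell_mean L1 L1' L2 L2' \<omega> N i j * (LINT p:cell i j|lebesgue. \<phi> p)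
      - (LINT p:cell i j|lebesgue. \<rho> p * \<omega> p * \<phi> p)\<bar>
    \<le> (2 * (norm_Linf (partial_x \<phi>) * h1 + norm_Linf (partial_y \<phi>) * h2) * norm_Linf \<omega>
        + (norm_Linf \<omega>x * h1 + norm_Linf \<omega>y * h2) * norm_Linf \<phi>) * (LINT p:cell i j|lebesgue. \<rho> p)"
proof -
  define a W \<delta> \<kappa> where "a = cell_mean L1 L1' L2 L2' \<rho> N i j" and "W = cell_mean L1 L1' L2 L2' \<omega> N i j"
    and "\<delta> = norm_Linf (partial_x \<phi>) * h1 + norm_Linf (partial_y \<phi>) * h2"
    and "\<kappa> = norm_Linf \<omega>x * h1 + norm_Linf \<omega>y * h2"
  let ?I = "\<lambda>f. LINT p:cell i j|lebesgue. f p"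
  have \<phi>_Linf: "Linf \<phi>" by (rule test_function_Linf[OF \<phi>])
  have int_\<rho>\<phi>: "integrable lebesgue (\<lambda>p. \<phi> p * \<rho> p)"
    by (intro integrable_Linf_mult \<phi>_Linf \<rho>)
  have int_\<rho>\<omega>\<phi>: "integrable lebesgue (\<lambda>p. \<omega> p * (\<phi> p * \<rho> p))"
    by (intro integrable_Linf_mult \<omega> int_\<rho>\<phi>)
  have set1: "set_integrable lebesgue (cell i j) (\<lambda>p. W * (\<rho> p * \<phi> p))"
    using int_\<rho>\<phi> by (intro set_integrable_of_integrable cell_measurable integrable_mult_right) (simp add: mult.commute)
  have set2: "set_integrable lebesgue (cell i j) (\<lambda>p. \<rho> p * \<omega> p * \<phi> p)"
    using int_\<rho>\<omega>\<phi> by (intro set_integrable_of_integrable cell_measurable) (simp add: mult_ac)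
  have "set_integrable lebesgue ({x i..x (Suc i)} \<times> {y j..y (Suc j)}) \<omega>"
    by (intro set_integrable_Linf \<omega> closed_box_lmeasurable)
  note mean = cell_mean_eq(2)[OF this]
  have osc: "AE p in lebesgue. p \<in> cell i j \<longrightarrow> \<bar>\<omega> p - W\<bar> \<le> \<kappa>"
    using weak_derivative_bounded_oscillation[OF \<omega>, of "x i" "x (Suc i)" "y j" "y (Suc j)"]
    unfolding W_def mean cell_def \<kappa>_def by (simp add: x_Suc y_Suc)
  have "\<bar>W * ?I (\<lambda>p. \<rho> p * \<phi> p) - ?I (\<lambda>p. \<rho> p * \<omega> p * \<phi> p)\<bar> = \<bar>?I (\<lambda>p. W * (\<rho> p * \<phi> p) - \<rho> p * \<omega> p * \<phi> p)\<bar>"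
    using set1 set2 by (simp add: set_integral_diff)
  also have "\<dots> \<le> ?I (\<lambda>p. \<bar>W * (\<rho> p * \<phi> p) - \<rho> p * \<omega> p * \<phi> p\<bar>)"
    unfolding set_lebesgue_integral_def
    by (rule order_trans[OF integral_abs_bound]) (simp add: abs_mult)
  also have "\<dots> \<le> ?I (\<lambda>p. \<kappa> * norm_Linf \<phi> * \<rho> p)"
    unfolding set_lebesgue_integral_def
  proof (rule integral_mono_AE')
    show "integrable lebesgue (\<lambda>p. indicator (cell i j) p *\<^sub>R (\<kappa> * norm_Linf \<phi> * \<rho> p))"
      unfolding set_integrable_def[symmetric]
      by (intro set_integrable_of_integrable cell_measurable integrable_mult_right \<rho>)
    show "AE p in lebesgue. indicator (cell i j) p *\<^sub>R \<bar>W * (\<rho> p * \<phi> p) - \<rho> p * \<omega> p * \<phi> p\<bar>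
        \<le> indicator (cell i j) p *\<^sub>R (\<kappa> * norm_Linf \<phi> * \<rho> p)"
      using osc \<rho>(2) Linf_AE_bound[OF \<phi>_Linf]
    proof eventually_elim
      case (elim p)
      have "\<bar>W * (\<rho> p * \<phi> p) - \<rho> p * \<omega> p * \<phi> p\<bar> = \<bar>\<omega> p - W\<bar> * \<bar>\<phi> p\<bar> * \<rho> p"
      proof -
        have "W * (\<rho> p * \<phi> p) - \<rho> p * \<omega> p * \<phi> p = - ((\<omega> p - W) * \<phi> p * \<rho> p)"
          by (simp add: algebra_simps)
        then show ?thesis using elim(2) by (simp only: abs_minus_cancel abs_mult abs_of_nonneg)
      qed
      moreover have "\<dots> \<le> \<kappa> * norm_Linf \<phi> * \<rho> p" if "p \<in> cell i j"
        using elim that by (intro mult_right_mono mult_mono) auto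
      ultimately show ?case by (auto simp: indicator_def)
    qed
    have "0 \<le> \<kappa>" using h_pos \<omega> by (auto simp: \<kappa>_def norm_Linf_nonneg)
    with norm_Linf_nonneg[OF \<phi>_Linf] have "0 \<le> \<kappa> * norm_Linf \<phi>" by simp
    then show "AE p in lebesgue. 0 \<le> indicator (cell i j) p *\<^sub>R (\<kappa> * norm_Linf \<phi> * \<rho> p)"
      using \<rho>(2) by (auto elim!: eventually_mono)
  qed
  also have "\<dots> = \<kappa> * norm_Linf \<phi> * ?I \<rho>" by simp
  finally have 2: "\<bar>W * ?I (\<lambda>p. \<rho> p * \<phi> p) - ?I (\<lambda>p. \<rho> p * \<omega> p * \<phi> p)\<bar> \<le> \<kappa> * norm_Linf \<phi> * ?I \<rho>" .
  have "\<bar>W * (a * ?I \<phi> - ?I (\<lambda>p. \<rho> p * \<phi> p))\<bar> \<le> norm_Linf \<omega> * (2 * \<delta> * ?I \<rho>)"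
    unfolding abs_mult W_def a_def \<delta>_def
    by (intro mult_mono cell_mean_bound \<omega> density_cell_bound \<phi> \<rho> norm_Linf_nonneg abs_ge_zero)
  \<comment> \<open>The splitting of the cell error into the two parts estimated above.\<close>
  moreover have "a * W * ?I \<phi> - ?I (\<lambda>p. \<rho> p * \<omega> p * \<phi> p)
      = W * (a * ?I \<phi> - ?I (\<lambda>p. \<rho> p * \<phi> p)) + (W * ?I (\<lambda>p. \<rho> p * \<phi> p) - ?I (\<lambda>p. \<rho> p * \<omega> p * \<phi> p))"
    by (simp add: algebra_simps)
  ultimately have "\<bar>a * W * ?I \<phi> - ?I (\<lambda>p. \<rho> p * \<omega> p * \<phi> p)\<bar>
      \<le> norm_Linf \<omega> * (2 * \<delta> * ?I \<rho>) + \<kappa> * norm_Linf \<phi> * ?I \<rho>"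
    using 2 by linarith
  also have "\<dots> = (2 * \<delta> * norm_Linf \<omega> + \<kappa> * norm_Linf \<phi>) * ?I \<rho>"
    by (simp add: algebra_simps)
  finally show ?thesis unfolding a_def W_def \<delta>_def \<kappa>_def .
qed

lemma spacing_bound:
  assumes "0 \<le> s" "0 \<le> t"
  shows "s * h1 + t * h2 \<le> max (L1 - L1') (L2 - L2') * (s + t) / N"
proof -
  have "h1 \<le> max (L1 - L1') (L2 - L2') / N" "h2 \<le> max (L1 - L1') (L2 - L2') / N"
    unfolding h1_def h2_def by (auto intro!: divide_right_mono)
  then have "s * h1 + t * h2 \<le> s * (max (L1 - L1') (L2 - L2') / N) + t * (max (L1 - L1') (L2 - L2') / N)"
    using assms by (intro add_mono mult_left_mono)
  also have "\<dots> = max (L1 - L1') (L2 - L2') * (s + t) / N"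
    by (simp add: add_divide_distrib algebra_simps)
  finally show ?thesis .
qed

lemma norm_L1_bound:
  assumes "Linf \<rho>" "AE p in lebesgue. p \<notin> {L1'..L1} \<times> {L2'..L2} \<longrightarrow> \<rho> p = 0"
  shows "norm_L1 \<rho> \<le> norm_Linf \<rho> * (L1 - L1') * (L2 - L2')"
proof -
  have int: "integrable lebesgue (\<lambda>p. indicator {L1'..L1} (fst p) * indicator {L2'..L2} (snd p) :: real)"
    by (intro tensor_integral integrable_indicator_Icc)
  have "norm_L1 \<rho> \<le> (LINT p|lebesgue. norm_Linf \<rho> * (indicator {L1'..L1} (fst p) * indicator {L2'..L2} (snd p)))"
    unfolding norm_L1_def
  proof (rule integral_mono_AE')
    show "AE p in lebesgue. \<bar>\<rho> p\<bar> \<le> norm_Linf \<rho> * (indicator {L1'..L1} (fst p) * indicator {L2'..L2} (snd p))"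
      using assms(2) Linf_AE_bound[OF assms(1)] by eventually_elim (auto simp: indicator_def mem_Times_iff)
  qed (use int norm_Linf_nonneg[OF assms(1)] in auto)
  also have "\<dots> = norm_Linf \<rho> * ((L1 - L1') * (L2 - L2'))"
    using L1 L2 by (simp add: tensor_integral integrable_indicator_Icc)
  finally show ?thesis by (simp add: mult.assoc)
qed

context
  fixes \<rho> \<phi> :: "real \<times> real \<Rightarrow> real"
  assumes \<rho>: "integrable lebesgue \<rho>" "Linf \<rho>" "AE p in lebesgue. 0 \<le> \<rho> p"
    "AE p in lebesgue. p \<notin> {L1'..L1} \<times> {L2'..L2} \<longrightarrow> \<rho> p = 0"
    and \<phi>: "test_function \<phi>"
begin

lemma norm_L1_eq: "norm_L1 \<rho> = (LINT p|lebesgue. \<rho> p)"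
  unfolding norm_L1_def using \<rho>(1,3) by (intro integral_cong_AE) (auto elim!: eventually_mono)

lemma test_function_integrable: "integrable lebesgue \<phi>"
proof -
  have K: "compact (closure {p. \<phi> p \<noteq> 0})" using \<phi> by (simp add: test_function_def)
  have "set_integrable lebesgue (closure {p. \<phi> p \<noteq> 0}) \<phi>"
    using K by (intro set_integrable_Linf test_function_Linf \<phi>) (rule lmeasurable_compact)
  moreover have "(\<lambda>p. indicator (closure {p. \<phi> p \<noteq> 0}) p *\<^sub>R \<phi> p) = \<phi>"
    using closure_subset[of "{p. \<phi> p \<noteq> 0}"] by (auto simp: indicator_def fun_eq_iff)
  ultimately show ?thesis by (simp only: set_integrable_def)
qed

text \<open>
  Of the two copies of the mass of \<open>\<rho>\<close>, one is kept as \<open>norm_L1 \<rho>\<close> and the other is estimated by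
  \<open>norm_L1_bound\<close>; together they form the last factor of \<open>D12\<close>.
\<close>

lemma oscillation_le_D12:
  "2 * (norm_Linf (partial_x \<phi>) * h1 + norm_Linf (partial_y \<phi>) * h2) * (LINT p|lebesgue. \<rho> p)
    \<le> D12 L1 L1' L2 L2' \<rho> \<phi> / N"
proof -
  let ?X = "norm_Linf (partial_x \<phi>)" and ?Y = "norm_Linf (partial_y \<phi>)" and ?M = "max (L1 - L1') (L2 - L2')"
  have nn: "0 \<le> ?X" "0 \<le> ?Y" "0 \<le> norm_L1 \<rho>"
    using test_function_Linf[OF \<phi>] by (auto simp: norm_Linf_nonneg norm_L1_def)
  have "2 * (?X * h1 + ?Y * h2) * (LINT p|lebesgue. \<rho> p) = (?X * h1 + ?Y * h2) * (2 * norm_L1 \<rho>)"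
    by (simp add: norm_L1_eq)
  also have "\<dots> \<le> (?M * (?X + ?Y) / N) * (norm_L1 \<rho> + norm_Linf \<rho> * (L1 - L1') * (L2 - L2'))"
    using spacing_bound[OF nn(1,2)] norm_L1_bound[OF \<rho>(2,4)] nn h_pos L1
    by (intro mult_mono) auto
  also have "\<dots> = D12 L1 L1' L2 L2' \<rho> \<phi> / N"
    by (simp add: D12_def)
  finally show ?thesis .
qed

lemma rho_hat_error:
  "\<bar>(LINT p|lebesgue. rho_hat L1 L1' L2 L2' \<rho> N p * \<phi> p) - (LINT p|lebesgue. \<rho> p * \<phi> p)\<bar>
    \<le> D12 L1 L1' L2 L2' \<rho> \<phi> / N"
proof -
  have int: "integrable lebesgue (\<lambda>p. \<rho> p * \<phi> p)"
    using integrable_Linf_mult[OF test_function_Linf(1)[OF \<phi>] \<rho>(1)] by (simp add: mult.commute)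
  show ?thesis
    unfolding rho_hat_def
    by (rule order_trans[OF integral_piecewise_const_diff_bound oscillation_le_D12,
          OF test_function_integrable int \<rho>(1,4) _ density_cell_bound[OF \<phi> \<rho>(1,3)]]) simp
qed

lemma rho_omega_hat_error:
  assumes \<omega>: "Linf \<omega>" "weak_partial_x \<omega> \<omega>x" "Linf \<omega>x" "weak_partial_y \<omega> \<omega>y" "Linf \<omega>y"
  shows "\<bar>(LINT p|lebesgue. rho_omega_hat L1 L1' L2 L2' \<rho> \<omega> N p * \<phi> p) - (LINT p|lebesgue. \<rho> p * \<omega> p * \<phi> p)\<bar>
    \<le> (K12 L1 L1' L2 L2' \<rho> \<omega>x \<omega>y \<phi> + D12 L1 L1' L2 L2' \<rho> \<phi> * norm_Linf \<omega>) / N"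
proof -
  let ?\<delta> = "norm_Linf (partial_x \<phi>) * h1 + norm_Linf (partial_y \<phi>) * h2"
    and ?\<kappa> = "norm_Linf \<omega>x * h1 + norm_Linf \<omega>y * h2"
  have \<phi>_Linf: "Linf \<phi>" by (rule test_function_Linf[OF \<phi>])
  have "integrable lebesgue (\<lambda>p. \<omega> p * (\<phi> p * \<rho> p))"
    by (intro integrable_Linf_mult \<omega> \<phi>_Linf \<rho>)
  then have int: "integrable lebesgue (\<lambda>p. \<rho> p * \<omega> p * \<phi> p)"
    by (simp add: mult_ac)
  have "\<bar>(LINT p|lebesgue. rho_omega_hat L1 L1' L2 L2' \<rho> \<omega> N p * \<phi> p) - (LINT p|lebesgue. \<rho> p * \<omega> p * \<phi> p)\<bar>
      \<le> (2 * ?\<delta> * norm_Linf \<omega> + ?\<kappa> * norm_Linf \<phi>) * (LINT p|lebesgue. \<rho> p)"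
    unfolding rho_omega_hat_def
    by (rule integral_piecewise_const_diff_bound[OF test_function_integrable int \<rho>(1,4) _
          density_velocity_cell_bound[OF \<phi> \<rho>(1,3) \<omega>]]) simp
  also have "\<dots> = 2 * ?\<delta> * (LINT p|lebesgue. \<rho> p) * norm_Linf \<omega> + ?\<kappa> * (norm_Linf \<phi> * norm_L1 \<rho>)"
    by (simp add: norm_L1_eq algebra_simps)
  also have "\<dots> \<le> D12 L1 L1' L2 L2' \<rho> \<phi> / N * norm_Linf \<omega>
      + (max (L1 - L1') (L2 - L2') * (norm_Linf \<omega>x + norm_Linf \<omega>y) / N) * (norm_Linf \<phi> * norm_L1 \<rho>)"
    using \<omega> \<phi>_Linf
    by (intro add_mono mult_right_mono oscillation_le_D12 spacing_bound mult_nonneg_nonneg norm_Linf_nonneg)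
      (auto simp: norm_L1_def)
  also have "\<dots> = (K12 L1 L1' L2 L2' \<rho> \<omega>x \<omega>y \<phi> + D12 L1 L1' L2 L2' \<rho> \<phi> * norm_Linf \<omega>) / N"
    by (simp add: K12_def add_divide_distrib mult.assoc)
  finally show ?thesis .
qed

end

end

theorem theorem1p3:
  fixes L1 L1' L2 L2' :: real and \<rho> :: "real \<times> real \<Rightarrow> real"
  assumes "L1' < L1" and "L2' < L2"
    and "integrable lebesgue \<rho>" and "Linf \<rho>"
    and "AE p in lebesgue. 0 \<le> \<rho> p"
    and "compact (ess_support \<rho>)" and "ess_support \<rho> \<subseteq> {L1'..L1} \<times> {L2'..L2}"
  shows
    "(\<forall>\<phi> N. test_function \<phi> \<and> 1 \<le> N \<longrightarrow>
        \<bar>(LINT p|lebesgue. rho_hat L1 L1' L2 L2' \<rho> N p * \<phi> p) - (LINT p|lebesgue. \<rho> p * \<phi> p)\<bar>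
          \<le> D12 L1 L1' L2 L2' \<rho> \<phi> / real N) \<and>
     (\<forall>\<omega> \<omega>x \<omega>y. Linf \<omega> \<and> weak_partial_x \<omega> \<omega>x \<and> Linf \<omega>x \<and> weak_partial_y \<omega> \<omega>y \<and> Linf \<omega>y \<longrightarrow>
        (\<forall>\<phi> N. test_function \<phi> \<and> 1 \<le> N \<longrightarrow>
          \<bar>(LINT p|lebesgue. rho_omega_hat L1 L1' L2 L2' \<rho> \<omega> N p * \<phi> p)
            - (LINT p|lebesgue. \<rho> p * \<omega> p * \<phi> p)\<bar>
          \<le> (K12 L1 L1' L2 L2' \<rho> \<omega>x \<omega>y \<phi> + D12 L1 L1' L2 L2' \<rho> \<phi> * norm_Linf \<omega>) / real N))"
proof -
  have outside: "AE p in lebesgue. p \<notin> {L1'..L1} \<times> {L2'..L2} \<longrightarrow> \<rho> p = 0"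
    using AE_zero_outside_ess_support[of \<rho>] by eventually_elim (use assms(7) in blast)
  have grid: "rectangular_grid L1 L1' L2 L2' N" if "1 \<le> N" for N
    using assms(1,2) that by unfold_locales
  show ?thesis
    using rectangular_grid.rho_hat_error[OF grid assms(3-5) outside]
      rectangular_grid.rho_omega_hat_error[OF grid assms(3-5) outside]
    by blast
qed

end
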